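(* Let $S=\{s_0,\dots,s_{n-1}\}$ be an input set of $n$ strings, no one of which is a substring of another, let $K$ be a nonnegative integer, and let $c$ be the length of the longest string in $S$. The full SCSK algorithm, which runs in succession MISTAKES_FOR_PAIRS, SCSK_FOR_TRIPLES, SCS_FIRST_LAST and finally the main loop (all four procedures are specified in the context), has time complexity $$O\left(n^3c^2\log c+n^32^n\right).$$
   Context: Problem ($SCS_K$). Given a set $S=\{s_0,\dots,s_{n-1}\}$ of $n$ nonempty strings, none a substring of another in $S$, and an integer $K\ge 0$, find the shortest string $L$ such that all but one string of $S$ are exact substrings of $L$ and the remaining string fits into $L$ (occupies a block of consecutive positions of $L$) with at most $K$ mistakes, a mistake being a position where the two strings differ. The algorithm below is proposed for this problem and returns a length; the claim concerns only its running time. Notation. All indexing is 0-based; $a_i$ is the character of $a$ at position $i$; $|a|$ is the length of a string or list $a$; $\oplus$ is bitwise XOR and $\&$ bitwise AND on integers. $\{a,\dots,b\}$ is empty if $a>b$. $\mathrm{BINARYSEARCH}(a,x)$ returns the first index in the sorted list $a$ whose entry is greater than $x$, or $|a|$ if there is none. Cost model. Each of the following costs $O(1)$: integer arithmetic, comparison, MIN, MAX, array access, reading a character, appending to a list, reading the length of a list, bitwise operations on integers below $2^n$, and computing a power $2^x$ with $x\le n$. $\mathrm{BINARYSEARCH}(a,x)$ costs $O(1+\log(1+|a|))$. $O(f(n,c))$ means: at most a constant times $f(n,c)$ for all inputs with $n\ge 1$ and $c\ge 2$. (1) MISTAKES_FOR_PAIRS. All lists $\mathrm{MISTAKES}_{i,j,k}$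 start empty. For $i\in\{0,\dots,n-1\}$, for $j\in\{0,\dots,n-1\}$ with $j\neq i$, for $k\in\{0,\dots,|s_i|+|s_j|-1\}$, for $t\in\{0,\dots,|s_j|-1\}$: set $x\leftarrow k-|s_j|+1+t$; if $0\le x<|s_i|$ and $(s_j)_t\neq (s_i)_x$, append $x$ to $\mathrm{MISTAKES}_{i,j,k}$. (So $\mathrm{MISTAKES}_{i,j,k}$ is the increasing list of positions of $s_i$ at which $s_i$ and $s_j$ mismatch when the last character of $s_j$ is aligned with position $k$ of $s_i$.) (2) SCSK_FOR_TRIPLES. All entries $\mathrm{LMR}_{l,m,r}$ start at $+\infty$. For $l$, for $r$, for $m$ in $\{0,\dots,n-1\}$: if $l,m,r$ are not pairwise distinct, continue. Put $L=s_l$, $M=s_m$, $R=s_r$. For $len\in\{\max(|L|,|R|),\dots,|L|+|R|+|M|\}$: if $len<|L|+|R|$ and $|\mathrm{MISTAKES}_{l,r,2|L|+|R|-len-1}|\neq 0$, continue. Otherwise, for $start\in\{0,\dots,len-|M|\}$: set $MS\leftarrow 0$, $E\leftarrow start+|M|-1$ and $E'\leftarrow E-(len-|R|)$, and then - if $E<|L|$: $MS\leftarrow|\mathrm{MISTAKES}_{l,m,E}|$; - else if $start\ge len-|R|$: $MS\leftarrow|\mathrm{MISTAKES}_{r,m,E'}|$; - else if $len\ge|L|+|R|$: if $start<|L|$ add $|\mathrm{MISTAKES}_{l,m,E}|$ to $MS$; then if $E'\ge 0$ add $|\mathrm{MISTAKES}_{r,m,E'}|$ to $MS$; - else: $MS\leftarrow|\mathrm{MISTAKES}_{l,m,E}|+|\mathrm{MISTAKES}_{r,m,E'}|-\mathrm{BINARYSEARCH}(\mathrm{MISTAKES}_{r,m,E'},\,|L|+|R|-len-1)$.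 After this, if $MS\le K$, set $\mathrm{LMR}_{l,m,r}\leftarrow\mathrm{MIN}(len,\mathrm{LMR}_{l,m,r})$. (3) SCS_FIRST_LAST, consisting of three steps run in order. - COUNT_OVERLAPS: all entries start at $0$. For $w,v\in\{0,\dots,n-1\}$: if $v=w$ set $\mathrm{OVERLAP}_{w,v}\leftarrow|s_v|$; otherwise for $o\in\{1,\dots,|s_w|\}$, if $|\mathrm{MISTAKES}_{v,w,o}|=0$ set $\mathrm{OVERLAP}_{w,v}\leftarrow o$. - FILL_DP_RIGHT: $\mathrm{DP\_RIGHT}_{2^j,j}=|s_j|$ for each $j$, all other entries start at $+\infty$. For $mask\in\{1,\dots,2^n-1\}$ in increasing order, for $right\in\{0,\dots,n-1\}$ with $2^{right}\,\&\,mask\neq 0$, for $p\in\{0,\dots,n-1\}$ with $2^{p}\,\&\,mask\neq0$ and $p\neq right$: set $\mathrm{DP\_RIGHT}_{mask,right}$ to the minimum of its current value and $\mathrm{DP\_RIGHT}_{mask\oplus 2^{right},p}+|s_{right}|-\mathrm{OVERLAP}_{p,right}$. - FILL_DP_LEFT: the same with "leftmost" in place of "rightmost": $\mathrm{DP\_LEFT}_{2^j,j}=|s_j|$, all other entries start at $+\infty$, and $\mathrm{DP\_LEFT}_{mask,left}$ is updated to the minimum of its current value and $\mathrm{DP\_LEFT}_{mask\oplus 2^{left},p}+|s_{left}|-\mathrm{OVERLAP}_{left,p}$, over $left$ and $p\neq left$ in $mask$. (4) Main loop. $ANS\leftarrow$ NULL. For $l$, for $m$, for $r$ in $\{0,\dots,n-1\}$: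 if $l,m,r$ are not pairwise distinct, continue. For $leftMask\in\{0,\dots,2^n-1\}$: put $rightMask\leftarrow(2^n-1)\oplus leftMask$; if $leftMask\,\&\,2^l=0$ or $rightMask\,\&\,2^r=0$, continue; put $length\leftarrow \mathrm{LMR}_{l,m,r}-|s_l|-|s_r|+\mathrm{DP\_RIGHT}_{leftMask,l}+\mathrm{DP\_LEFT}_{rightMask,r}$; if $ANS$ is NULL or $length<ANS$, set $ANS\leftarrow length$. Return $ANS$. *)

theory Defs
  imports
    Complex_Main
    "HOL-Library.State_Monad"
    "HOL-Library.Extended"
    "HOL-Library.Sublist"
begin

section \<open>Elementary operations and their costs\<close>

text \<open>
  A program records every elementary operation it executes in a trace; its running time is
  the sum of the costs of the operations in that trace. Bitwise operations and powers carry
  their operands, and a binary search carries the length of the list searched, because the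
  bound on their cost depends on these.
\<close>

datatype operation =
    Arith | Compare | MinMax | Access | ReadChar | Append | Length
  | Bitwise int int
  | Power2 int
  | BinSearch nat

text \<open>
  \<open>cost n p\<close> is the cost of the operation \<open>p\<close> on an input of \<open>n\<close> strings. Bitwise operations
  and powers are bounded only on integers below \<open>2 ^ n\<close> and for exponents up to \<open>n\<close>.
\<close>

definition cost_model :: "(nat \<Rightarrow> operation \<Rightarrow> real) \<Rightarrow> bool" where
  "cost_model cost \<longleftrightarrow>
     (\<forall>n p. 0 \<le> cost n p) \<and>
     (\<exists>B. \<forall>n.
        (\<forall>p\<in>{Arith, Compare, MinMax, Access, ReadChar, Append, Length}. cost n p \<le> B) \<and>
        (\<forall>a b. 0 \<le> a \<and> a < 2 ^ n \<and> 0 \<le> b \<and> b < 2 ^ n \<longrightarrow> cost n (Bitwise a b) \<le> B) \<and>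
        (\<forall>x. 0 \<le> x \<and> x \<le> int n \<longrightarrow> cost n (Power2 x) \<le> B) \<and>
        (\<forall>m. cost n (BinSearch m) \<le> B * (1 + log 2 (1 + real m))))"


section \<open>Programs\<close>

text \<open>
  The tables are the arrays of the algorithm, indexed by tuples of integers, and \<open>ans\<close> is
  \<open>None\<close> for NULL. The latest operation is at the head of \<open>trace\<close>.
\<close>

record store =
  mistakes :: "int \<times> int \<times> int \<Rightarrow> int list"
  lmr :: "int \<times> int \<times> int \<Rightarrow> int extended"
  overlap :: "int \<times> int \<Rightarrow> int"
  dp_right :: "int \<times> int \<Rightarrow> int extended"
  dp_left :: "int \<times> int \<Rightarrow> int extended"
  ans :: "int extended option"
  trace :: "operation list"

definition initial_store :: store where
  "initial_store =
     \<lparr>mistakes = (\<lambda>_. []), lmr = (\<lambda>_. \<infinity>), overlap = (\<lambda>_. 0),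
      dp_right = (\<lambda>_. \<infinity>), dp_left = (\<lambda>_. \<infinity>), ans = None, trace = []\<rparr>"

type_synonym 'a prog = "(store, 'a) state"

definition tick :: "operation \<Rightarrow> unit prog" where
  "tick p = State_Monad.update (\<lambda>\<sigma>. \<sigma>\<lparr>trace := p # trace \<sigma>\<rparr>)"

subsection \<open>Expressions\<close>

text \<open>
  Expressions are programs whose operators charge for themselves (the bold symbols below).
  \<open>\<langle>x\<rangle>\<close> is a constant or the value of a local variable and costs nothing.
\<close>

definition val :: "'a \<Rightarrow> 'a prog" (\<open>\<langle>_\<rangle>\<close>) where
  "\<langle>x\<rangle> = State_Monad.return x"

definition binop :: "operation \<Rightarrow> ('a \<Rightarrow> 'b \<Rightarrow> 'c) \<Rightarrow> 'a prog \<Rightarrow> 'b prog \<Rightarrow> 'c prog" where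
  "binop p f a b = do { x \<leftarrow> a; y \<leftarrow> b; tick p; \<langle>f x y\<rangle> }"

definition add_expr :: "'a::plus prog \<Rightarrow> 'a prog \<Rightarrow> 'a prog" (infixl \<open>\<^bold>+\<close> 65) where
  "a \<^bold>+ b = binop Arith (+) a b"

definition sub_expr :: "'a::minus prog \<Rightarrow> 'a prog \<Rightarrow> 'a prog" (infixl \<open>\<^bold>-\<close> 65) where
  "a \<^bold>- b = binop Arith (-) a b"

definition min_expr :: "'a::linorder prog \<Rightarrow> 'a prog \<Rightarrow> 'a prog" where
  "min_expr a b = binop MinMax min a b"

definition max_expr :: "'a::linorder prog \<Rightarrow> 'a prog \<Rightarrow> 'a prog" where
  "max_expr a b = binop MinMax max a b"

definition eq_expr :: "'a prog \<Rightarrow> 'a prog \<Rightarrow> bool prog" (infix \<open>\<^bold>=\<close> 50) where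
  "(a \<^bold>= b) = binop Compare (=) a b"

definition neq_expr :: "'a prog \<Rightarrow> 'a prog \<Rightarrow> bool prog" (infix \<open>\<^bold>\<noteq>\<close> 50) where
  "(a \<^bold>\<noteq> b) = binop Compare (\<noteq>) a b"

definition le_expr :: "'a::ord prog \<Rightarrow> 'a prog \<Rightarrow> bool prog" (infix \<open>\<^bold>\<le>\<close> 50) where
  "(a \<^bold>\<le> b) = binop Compare (\<le>) a b"

definition less_expr :: "'a::ord prog \<Rightarrow> 'a prog \<Rightarrow> bool prog" (infix \<open>\<^bold><\<close> 50) where
  "(a \<^bold>< b) = binop Compare (<) a b"

definition bitop :: "(int \<Rightarrow> int \<Rightarrow> int) \<Rightarrow> int prog \<Rightarrow> int prog \<Rightarrow> int prog" where
  "bitop f a b = do { x \<leftarrow> a; y \<leftarrow> b; tick (Bitwise x y); \<langle>f x y\<rangle> }"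

definition xor_expr :: "int prog \<Rightarrow> int prog \<Rightarrow> int prog" (infixl \<open>\<^bold>\<oplus>\<close> 60) where
  "a \<^bold>\<oplus> b = bitop semiring_bit_operations_class.xor a b"

definition and_expr :: "int prog \<Rightarrow> int prog \<Rightarrow> int prog" (infixl \<open>\<^bold>&\<close> 60) where
  "a \<^bold>& b = bitop semiring_bit_operations_class.and a b"

definition pow2 :: "int \<Rightarrow> int prog" where
  "pow2 x = do { tick (Power2 x); \<langle>2 ^ nat x\<rangle> }"

definition fin :: "int prog \<Rightarrow> int extended prog" where
  "fin a = do { x \<leftarrow> a; \<langle>Fin x\<rangle> }"

subsection \<open>Control flow\<close>

definition cond :: "bool prog \<Rightarrow> 'a prog \<Rightarrow> 'a prog \<Rightarrow> 'a prog"
    (\<open>(IF (_)/ THEN (_)/ ELSE (_))\<close> [0, 0, 10] 10) where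
  "(IF b THEN p ELSE q) = do { x \<leftarrow> b; if x then p else q }"

definition conj_expr :: "bool prog \<Rightarrow> bool prog \<Rightarrow> bool prog" (infixr \<open>\<^bold>\<and>\<close> 35) where
  "(a \<^bold>\<and> b) = (IF a THEN b ELSE \<langle>False\<rangle>)"

definition disj_expr :: "bool prog \<Rightarrow> bool prog \<Rightarrow> bool prog" (infixr \<open>\<^bold>\<or>\<close> 30) where
  "(a \<^bold>\<or> b) = (IF a THEN \<langle>True\<rangle> ELSE b)"

abbreviation skip :: "unit prog" where
  "skip \<equiv> \<langle>()\<rangle>"

text \<open>
  The loop over \<open>{a, \<dots>, b}\<close> pays for the test of the loop variable, including the final
  failing one, and for its increment. \<open>[a..b]\<close> is empty if \<open>b < a\<close>.
\<close>

definition for_loop :: "int prog \<Rightarrow> int prog \<Rightarrow> (int \<Rightarrow> unit prog) \<Rightarrow> unit prog" where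
  "for_loop lo hi body = do {
     a \<leftarrow> lo;
     b \<leftarrow> hi;
     foldr (\<lambda>i rest. do { tick Compare; body i; tick Arith; rest }) [a..b] (tick Compare)
   }"

subsection \<open>Input strings and tables\<close>

definition num_strings :: "'a list list \<Rightarrow> int prog" where
  "num_strings ss = do { tick Length; \<langle>int (length ss)\<rangle> }"

definition str_len :: "'a list list \<Rightarrow> int \<Rightarrow> int prog" where
  "str_len ss i = do { tick Access; tick Length; \<langle>int (length (ss ! nat i))\<rangle> }"

definition char_at :: "'a list list \<Rightarrow> int \<Rightarrow> int \<Rightarrow> 'a prog" where
  "char_at ss i x = do { tick Access; tick ReadChar; \<langle>ss ! nat i ! nat x\<rangle> }"

definition fetch :: "(store \<Rightarrow> 'a) \<Rightarrow> 'a prog" where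
  "fetch f = do { tick Access; \<sigma> \<leftarrow> State_Monad.get; \<langle>f \<sigma>\<rangle> }"

definition num_mistakes :: "int \<Rightarrow> int \<Rightarrow> int \<Rightarrow> int prog" where
  "num_mistakes i j k = do {
     xs \<leftarrow> fetch (\<lambda>\<sigma>. mistakes \<sigma> (i, j, k));
     tick Length;
     \<langle>int (length xs)\<rangle>
   }"

text \<open>On any list, the number of leading entries that are at most \<open>x\<close> is the first index whose
  entry is greater than \<open>x\<close>, or the length of the list if there is none.\<close>

definition binary_search :: "int list \<Rightarrow> int \<Rightarrow> int prog" where
  "binary_search xs x = do {
     tick (BinSearch (length xs));
     \<langle>int (length (takeWhile (\<lambda>y. y \<le> x) xs))\<rangle>
   }"

definition set_mistakes :: "int \<Rightarrow> int \<Rightarrow> int \<Rightarrow> int list \<Rightarrow> unit prog" where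
  "set_mistakes i j k xs = do {
     tick Access;
     State_Monad.update (\<lambda>\<sigma>. \<sigma>\<lparr>mistakes := (mistakes \<sigma>)((i, j, k) := xs)\<rparr>)
   }"

definition append_mistake :: "int \<Rightarrow> int \<Rightarrow> int \<Rightarrow> int \<Rightarrow> unit prog" where
  "append_mistake i j k x = do {
     tick Access;
     tick Append;
     State_Monad.update
       (\<lambda>\<sigma>. \<sigma>\<lparr>mistakes := (mistakes \<sigma>)((i, j, k) := mistakes \<sigma> (i, j, k) @ [x])\<rparr>)
   }"

definition set_lmr :: "int \<Rightarrow> int \<Rightarrow> int \<Rightarrow> int extended \<Rightarrow> unit prog" where
  "set_lmr l m r v = do {
     tick Access;
     State_Monad.update (\<lambda>\<sigma>. \<sigma>\<lparr>lmr := (lmr \<sigma>)((l, m, r) := v)\<rparr>)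
   }"

definition set_overlap :: "int \<Rightarrow> int \<Rightarrow> int \<Rightarrow> unit prog" where
  "set_overlap w v x = do {
     tick Access;
     State_Monad.update (\<lambda>\<sigma>. \<sigma>\<lparr>overlap := (overlap \<sigma>)((w, v) := x)\<rparr>)
   }"

definition set_dp_right :: "int \<Rightarrow> int \<Rightarrow> int extended \<Rightarrow> unit prog" where
  "set_dp_right msk j x = do {
     tick Access;
     State_Monad.update (\<lambda>\<sigma>. \<sigma>\<lparr>dp_right := (dp_right \<sigma>)((msk, j) := x)\<rparr>)
   }"

definition set_dp_left :: "int \<Rightarrow> int \<Rightarrow> int extended \<Rightarrow> unit prog" where
  "set_dp_left msk j x = do {
     tick Access;
     State_Monad.update (\<lambda>\<sigma>. \<sigma>\<lparr>dp_left := (dp_left \<sigma>)((msk, j) := x)\<rparr>)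
   }"

definition set_ans :: "int extended option \<Rightarrow> unit prog" where
  "set_ans x = do {
     tick Access;
     State_Monad.update (\<lambda>\<sigma>. \<sigma>\<lparr>ans := x\<rparr>)
   }"


section \<open>The algorithm\<close>

text \<open>
  The initial values of the tables are written, and paid for, entry by entry, although
  \<open>initial_store\<close> already has them.
  A \<open>continue\<close> becomes a conditional around the rest of the loop body.
\<close>

definition MISTAKES_FOR_PAIRS :: "'a list list \<Rightarrow> unit prog" where
  "MISTAKES_FOR_PAIRS ss = do {
     n \<leftarrow> num_strings ss;
     for_loop \<langle>0\<rangle> (\<langle>n\<rangle> \<^bold>- \<langle>1\<rangle>) (\<lambda>i.
       for_loop \<langle>0\<rangle> (\<langle>n\<rangle> \<^bold>- \<langle>1\<rangle>) (\<lambda>j.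
         IF \<langle>j\<rangle> \<^bold>\<noteq> \<langle>i\<rangle> THEN
           for_loop \<langle>0\<rangle> (str_len ss i \<^bold>+ str_len ss j \<^bold>- \<langle>1\<rangle>) (\<lambda>k. set_mistakes i j k [])
         ELSE skip));
     for_loop \<langle>0\<rangle> (\<langle>n\<rangle> \<^bold>- \<langle>1\<rangle>) (\<lambda>i.
       for_loop \<langle>0\<rangle> (\<langle>n\<rangle> \<^bold>- \<langle>1\<rangle>) (\<lambda>j.
         IF \<langle>j\<rangle> \<^bold>\<noteq> \<langle>i\<rangle> THEN
           for_loop \<langle>0\<rangle> (str_len ss i \<^bold>+ str_len ss j \<^bold>- \<langle>1\<rangle>) (\<lambda>k.
             for_loop \<langle>0\<rangle> (str_len ss j \<^bold>- \<langle>1\<rangle>) (\<lambda>t. do {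
               x \<leftarrow> \<langle>k\<rangle> \<^bold>- str_len ss j \<^bold>+ \<langle>1\<rangle> \<^bold>+ \<langle>t\<rangle>;
               IF \<langle>0\<rangle> \<^bold>\<le> \<langle>x\<rangle> \<^bold>\<and> \<langle>x\<rangle> \<^bold>< str_len ss i \<^bold>\<and> char_at ss j t \<^bold>\<noteq> char_at ss i x
               THEN append_mistake i j k x
               ELSE skip
             }))
         ELSE skip))
   }"

definition pairwise_distinct :: "int \<Rightarrow> int \<Rightarrow> int \<Rightarrow> bool prog" where
  "pairwise_distinct l m r = (\<langle>l\<rangle> \<^bold>\<noteq> \<langle>m\<rangle> \<^bold>\<and> \<langle>m\<rangle> \<^bold>\<noteq> \<langle>r\<rangle> \<^bold>\<and> \<langle>l\<rangle> \<^bold>\<noteq> \<langle>r\<rangle>)"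

definition count_MS :: "'a list list \<Rightarrow> int \<Rightarrow> int \<Rightarrow> int \<Rightarrow> int \<Rightarrow> int \<Rightarrow> int prog" where
  "count_MS ss l m r len start = do {
     E \<leftarrow> \<langle>start\<rangle> \<^bold>+ str_len ss m \<^bold>- \<langle>1\<rangle>;
     E' \<leftarrow> \<langle>E\<rangle> \<^bold>- (\<langle>len\<rangle> \<^bold>- str_len ss r);
     IF \<langle>E\<rangle> \<^bold>< str_len ss l THEN num_mistakes l m E
     ELSE IF \<langle>len\<rangle> \<^bold>- str_len ss r \<^bold>\<le> \<langle>start\<rangle> THEN num_mistakes r m E'
     ELSE IF str_len ss l \<^bold>+ str_len ss r \<^bold>\<le> \<langle>len\<rangle> THEN do {
       MS \<leftarrow> (IF \<langle>start\<rangle> \<^bold>< str_len ss l THEN \<langle>0\<rangle> \<^bold>+ num_mistakes l m E ELSE \<langle>0\<rangle>);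
       IF \<langle>0\<rangle> \<^bold>\<le> \<langle>E'\<rangle> THEN \<langle>MS\<rangle> \<^bold>+ num_mistakes r m E' ELSE \<langle>MS\<rangle>
     }
     ELSE do {
       xs \<leftarrow> fetch (\<lambda>\<sigma>. mistakes \<sigma> (r, m, E'));
       x \<leftarrow> str_len ss l \<^bold>+ str_len ss r \<^bold>- \<langle>len\<rangle> \<^bold>- \<langle>1\<rangle>;
       num_mistakes l m E \<^bold>+ num_mistakes r m E' \<^bold>- binary_search xs x
     }
   }"

definition SCSK_FOR_TRIPLES :: "'a list list \<Rightarrow> nat \<Rightarrow> unit prog" where
  "SCSK_FOR_TRIPLES ss K = do {
     n \<leftarrow> num_strings ss;
     for_loop \<langle>0\<rangle> (\<langle>n\<rangle> \<^bold>- \<langle>1\<rangle>) (\<lambda>l.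
       for_loop \<langle>0\<rangle> (\<langle>n\<rangle> \<^bold>- \<langle>1\<rangle>) (\<lambda>m.
         for_loop \<langle>0\<rangle> (\<langle>n\<rangle> \<^bold>- \<langle>1\<rangle>) (\<lambda>r. set_lmr l m r \<infinity>)));
     for_loop \<langle>0\<rangle> (\<langle>n\<rangle> \<^bold>- \<langle>1\<rangle>) (\<lambda>l.
       for_loop \<langle>0\<rangle> (\<langle>n\<rangle> \<^bold>- \<langle>1\<rangle>) (\<lambda>r.
         for_loop \<langle>0\<rangle> (\<langle>n\<rangle> \<^bold>- \<langle>1\<rangle>) (\<lambda>m.
           IF pairwise_distinct l m r THEN
             for_loop (max_expr (str_len ss l) (str_len ss r))
                 (str_len ss l \<^bold>+ str_len ss r \<^bold>+ str_len ss m) (\<lambda>len.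
               IF \<langle>len\<rangle> \<^bold>< str_len ss l \<^bold>+ str_len ss r \<^bold>\<and>
                  (do {
                     k \<leftarrow> str_len ss l \<^bold>+ str_len ss l \<^bold>+ str_len ss r \<^bold>- \<langle>len\<rangle> \<^bold>- \<langle>1\<rangle>;
                     num_mistakes l r k
                   }) \<^bold>\<noteq> \<langle>0\<rangle>
               THEN skip
               ELSE for_loop \<langle>0\<rangle> (\<langle>len\<rangle> \<^bold>- str_len ss m) (\<lambda>start. do {
                 MS \<leftarrow> count_MS ss l m r len start;
                 IF \<langle>MS\<rangle> \<^bold>\<le> \<langle>int K\<rangle> THEN do {
                   v \<leftarrow> min_expr \<langle>Fin len\<rangle> (fetch (\<lambda>\<sigma>. lmr \<sigma> (l, m, r)));
                   set_lmr l m r v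
                 }
                 ELSE skip
               }))
           ELSE skip)))
   }"

definition COUNT_OVERLAPS :: "'a list list \<Rightarrow> unit prog" where
  "COUNT_OVERLAPS ss = do {
     n \<leftarrow> num_strings ss;
     for_loop \<langle>0\<rangle> (\<langle>n\<rangle> \<^bold>- \<langle>1\<rangle>) (\<lambda>w.
       for_loop \<langle>0\<rangle> (\<langle>n\<rangle> \<^bold>- \<langle>1\<rangle>) (\<lambda>v. set_overlap w v 0));
     for_loop \<langle>0\<rangle> (\<langle>n\<rangle> \<^bold>- \<langle>1\<rangle>) (\<lambda>w.
       for_loop \<langle>0\<rangle> (\<langle>n\<rangle> \<^bold>- \<langle>1\<rangle>) (\<lambda>v.
         IF \<langle>v\<rangle> \<^bold>= \<langle>w\<rangle> THEN do {
           x \<leftarrow> str_len ss v;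
           set_overlap w v x
         }
         ELSE for_loop \<langle>1\<rangle> (str_len ss w) (\<lambda>ov.
           IF num_mistakes v w ov \<^bold>= \<langle>0\<rangle> THEN set_overlap w v ov ELSE skip)))
   }"

definition FILL_DP_RIGHT :: "'a list list \<Rightarrow> unit prog" where
  "FILL_DP_RIGHT ss = do {
     n \<leftarrow> num_strings ss;
     for_loop \<langle>0\<rangle> (pow2 n \<^bold>- \<langle>1\<rangle>) (\<lambda>msk.
       for_loop \<langle>0\<rangle> (\<langle>n\<rangle> \<^bold>- \<langle>1\<rangle>) (\<lambda>j. set_dp_right msk j \<infinity>));
     for_loop \<langle>0\<rangle> (\<langle>n\<rangle> \<^bold>- \<langle>1\<rangle>) (\<lambda>j. do {
       msk \<leftarrow> pow2 j;
       x \<leftarrow> fin (str_len ss j);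
       set_dp_right msk j x
     });
     for_loop \<langle>1\<rangle> (pow2 n \<^bold>- \<langle>1\<rangle>) (\<lambda>msk.
       for_loop \<langle>0\<rangle> (\<langle>n\<rangle> \<^bold>- \<langle>1\<rangle>) (\<lambda>right.
         IF pow2 right \<^bold>& \<langle>msk\<rangle> \<^bold>\<noteq> \<langle>0\<rangle> THEN
           for_loop \<langle>0\<rangle> (\<langle>n\<rangle> \<^bold>- \<langle>1\<rangle>) (\<lambda>p.
             IF pow2 p \<^bold>& \<langle>msk\<rangle> \<^bold>\<noteq> \<langle>0\<rangle> \<^bold>\<and> \<langle>p\<rangle> \<^bold>\<noteq> \<langle>right\<rangle> THEN do {
               msk' \<leftarrow> \<langle>msk\<rangle> \<^bold>\<oplus> pow2 right;
               v \<leftarrow> min_expr (fetch (\<lambda>\<sigma>. dp_right \<sigma> (msk, right)))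
                     (fetch (\<lambda>\<sigma>. dp_right \<sigma> (msk', p)) \<^bold>+ fin (str_len ss right)
                       \<^bold>- fin (fetch (\<lambda>\<sigma>. overlap \<sigma> (p, right))));
               set_dp_right msk right v
             }
             ELSE skip)
         ELSE skip))
   }"

definition FILL_DP_LEFT :: "'a list list \<Rightarrow> unit prog" where
  "FILL_DP_LEFT ss = do {
     n \<leftarrow> num_strings ss;
     for_loop \<langle>0\<rangle> (pow2 n \<^bold>- \<langle>1\<rangle>) (\<lambda>msk.
       for_loop \<langle>0\<rangle> (\<langle>n\<rangle> \<^bold>- \<langle>1\<rangle>) (\<lambda>j. set_dp_left msk j \<infinity>));
     for_loop \<langle>0\<rangle> (\<langle>n\<rangle> \<^bold>- \<langle>1\<rangle>) (\<lambda>j. do {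
       msk \<leftarrow> pow2 j;
       x \<leftarrow> fin (str_len ss j);
       set_dp_left msk j x
     });
     for_loop \<langle>1\<rangle> (pow2 n \<^bold>- \<langle>1\<rangle>) (\<lambda>msk.
       for_loop \<langle>0\<rangle> (\<langle>n\<rangle> \<^bold>- \<langle>1\<rangle>) (\<lambda>left.
         IF pow2 left \<^bold>& \<langle>msk\<rangle> \<^bold>\<noteq> \<langle>0\<rangle> THEN
           for_loop \<langle>0\<rangle> (\<langle>n\<rangle> \<^bold>- \<langle>1\<rangle>) (\<lambda>p.
             IF pow2 p \<^bold>& \<langle>msk\<rangle> \<^bold>\<noteq> \<langle>0\<rangle> \<^bold>\<and> \<langle>p\<rangle> \<^bold>\<noteq> \<langle>left\<rangle> THEN do {
               msk' \<leftarrow> \<langle>msk\<rangle> \<^bold>\<oplus> pow2 left;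
               v \<leftarrow> min_expr (fetch (\<lambda>\<sigma>. dp_left \<sigma> (msk, left)))
                     (fetch (\<lambda>\<sigma>. dp_left \<sigma> (msk', p)) \<^bold>+ fin (str_len ss left)
                       \<^bold>- fin (fetch (\<lambda>\<sigma>. overlap \<sigma> (left, p))));
               set_dp_left msk left v
             }
             ELSE skip)
         ELSE skip))
   }"

definition SCS_FIRST_LAST :: "'a list list \<Rightarrow> unit prog" where
  "SCS_FIRST_LAST ss = do { COUNT_OVERLAPS ss; FILL_DP_RIGHT ss; FILL_DP_LEFT ss }"

definition MAIN_LOOP :: "'a list list \<Rightarrow> int extended option prog" where
  "MAIN_LOOP ss = do {
     n \<leftarrow> num_strings ss;
     set_ans None;
     for_loop \<langle>0\<rangle> (\<langle>n\<rangle> \<^bold>- \<langle>1\<rangle>) (\<lambda>l.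
       for_loop \<langle>0\<rangle> (\<langle>n\<rangle> \<^bold>- \<langle>1\<rangle>) (\<lambda>m.
         for_loop \<langle>0\<rangle> (\<langle>n\<rangle> \<^bold>- \<langle>1\<rangle>) (\<lambda>r.
           IF pairwise_distinct l m r THEN
             for_loop \<langle>0\<rangle> (pow2 n \<^bold>- \<langle>1\<rangle>) (\<lambda>leftMask. do {
               rightMask \<leftarrow> (pow2 n \<^bold>- \<langle>1\<rangle>) \<^bold>\<oplus> \<langle>leftMask\<rangle>;
               IF \<langle>leftMask\<rangle> \<^bold>& pow2 l \<^bold>= \<langle>0\<rangle> \<^bold>\<or> \<langle>rightMask\<rangle> \<^bold>& pow2 r \<^bold>= \<langle>0\<rangle> THEN skip
               ELSE do {
                 length' \<leftarrow> fetch (\<lambda>\<sigma>. lmr \<sigma> (l, m, r))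
                   \<^bold>- fin (str_len ss l) \<^bold>- fin (str_len ss r)
                   \<^bold>+ fetch (\<lambda>\<sigma>. dp_right \<sigma> (leftMask, l))
                   \<^bold>+ fetch (\<lambda>\<sigma>. dp_left \<sigma> (rightMask, r));
                 IF fetch ans \<^bold>= \<langle>None\<rangle> \<^bold>\<or> \<langle>length'\<rangle> \<^bold>< map_state the (fetch ans)
                 THEN set_ans (Some length')
                 ELSE skip
               }
             })
           ELSE skip)));
     fetch ans
   }"

definition SCSK :: "'a list list \<Rightarrow> nat \<Rightarrow> int extended option prog" where
  "SCSK ss K = do {
     MISTAKES_FOR_PAIRS ss;
     SCSK_FOR_TRIPLES ss K;
     SCS_FIRST_LAST ss;
     MAIN_LOOP ss
   }"


section \<open>Inputs and running time\<close>

definition valid_input :: "'a list list \<Rightarrow> bool" where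
  "valid_input ss \<longleftrightarrow>
     (\<forall>s\<in>set ss. s \<noteq> []) \<and>
     (\<forall>i<length ss. \<forall>j<length ss. i \<noteq> j \<longrightarrow> \<not> sublist (ss ! i) (ss ! j))"

definition max_length :: "'a list list \<Rightarrow> nat" where
  "max_length ss = Max (length ` set ss)"

definition running_time :: "(nat \<Rightarrow> operation \<Rightarrow> real) \<Rightarrow> 'a list list \<Rightarrow> nat \<Rightarrow> real" where
  "running_time cost ss K =
     (\<Sum>p\<leftarrow>trace (snd (run_state (SCSK ss K) initial_store)). cost (length ss) p)"

end

theory Submission
  imports Defs
begin

text \<open>
  All loop ranges depend only on the input, so the number of operations is bounded by multiplying
  range lengths: the searches over triples cost \<open>n\<^sup>3\<close> times \<open>O(c)\<close> lengths times \<open>O(c)\<close> starting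
  positions, and the loops over masks cost at most \<open>2\<^sup>n\<close> times \<open>n\<^sup>3\<close>. The only step whose cost is not
  constant is a binary search, which costs \<open>O(log c)\<close> because no list of mistakes is longer
  than \<open>c\<close>; this is the one invariant of the store that is needed.
\<close>

section \<open>Programs with a cost bound\<close>

text \<open>The cost model bounds a bitwise operation only for operands in \<open>[0, 2^n)\<close>
  and a power only for exponents up to \<open>n\<close>. Multiplying range lengths is therefore not
  enough: loop ranges and returned values must also certify the operands. A Hoare triple that
  carries an additive time bound does both. Its precondition sees the store and its postcondition
  sees the returned value. Ticks modify the store as well, so every invariant that is carried
  through a loop has to ignore \<open>trace\<close>. Bounds have the form \<open>T * B\<close>, with
  \<open>B\<close> the constant of the cost model and \<open>T\<close> explicit in \<open>n\<close>
  and \<open>c\<close>. Since \<open>T\<close> and all iteration counts are replaced by quantities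
  that are at least 1, fixed overheads can be absorbed into products. The large numerals are rounded
  up generously so that the closing inequalities are crude.\<close>

definition time :: "(operation \<Rightarrow> real) \<Rightarrow> store \<Rightarrow> real" where
  "time w \<sigma> = (\<Sum>p\<leftarrow>trace \<sigma>. w p)"

definition runs ::
    "(operation \<Rightarrow> real) \<Rightarrow> real \<Rightarrow> (store \<Rightarrow> bool) \<Rightarrow> 'a prog \<Rightarrow> ('a \<Rightarrow> store \<Rightarrow> bool) \<Rightarrow> bool" where
  "runs w T P p Q \<longleftrightarrow>
     (\<forall>\<sigma>. P \<sigma> \<longrightarrow> (case run_state p \<sigma> of (x, \<sigma>') \<Rightarrow> Q x \<sigma>' \<and> time w \<sigma>' \<le> time w \<sigma> + T))"

lemma runs_time:
  assumes "runs w T P p Q" and "P \<sigma>"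
  shows "time w (snd (run_state p \<sigma>)) \<le> time w \<sigma> + T"
  using assms by (cases "run_state p \<sigma>") (auto simp: runs_def)

section \<open>Evaluation of programs on a store\<close>

lemma run_state_bind:
  "run_state (State_Monad.bind p f) \<sigma> = (case run_state p \<sigma> of (x, \<sigma>') \<Rightarrow> run_state (f x) \<sigma>')"
  by (simp add: State_Monad.bind_def)

lemma run_state_if: "run_state (if b then p else q) \<sigma> = (if b then run_state p \<sigma> else run_state q \<sigma>)"
  by simp

lemma run_state_val: "run_state \<langle>x\<rangle> \<sigma> = (x, \<sigma>)"
  by (simp add: val_def State_Monad.return_def)

lemma run_state_update: "run_state (State_Monad.update f) \<sigma> = ((), f \<sigma>)"
  by (simp add: State_Monad.update_def State_Monad.get_def State_Monad.set_def State_Monad.bind_def)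

lemma run_state_get: "run_state State_Monad.get \<sigma> = (\<sigma>, \<sigma>)"
  by (simp add: State_Monad.get_def)

lemma run_state_map_state: "run_state (map_state f p) \<sigma> = (case run_state p \<sigma> of (x, \<sigma>') \<Rightarrow> (f x, \<sigma>'))"
  by (cases p) (auto split: prod.splits)

lemmas run_state_simps =
  run_state_bind run_state_if run_state_val run_state_update run_state_get run_state_map_state

lemma run_state_tick: "run_state (tick p) \<sigma> = ((), \<sigma>\<lparr>trace := p # trace \<sigma>\<rparr>)"
  by (simp add: tick_def run_state_simps)

lemmas expr_defs =
  binop_def add_expr_def sub_expr_def min_expr_def max_expr_def eq_expr_def neq_expr_def
  le_expr_def less_expr_def bitop_def xor_expr_def and_expr_def pow2_def fin_def cond_def
  conj_expr_def disj_expr_def num_strings_def str_len_def char_at_def fetch_def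
  num_mistakes_def binary_search_def set_mistakes_def append_mistake_def set_lmr_def
  set_overlap_def set_dp_right_def set_dp_left_def set_ans_def pairwise_distinct_def

text \<open>Unfolding with these rules executes a straight-line program symbolically and leaves a
  linear inequality between the costs of its ticks. \<open>for_loop_def\<close> is left out on
  purpose: loops are handled only by the rules below.\<close>

lemmas exec_simps = runs_def time_def expr_defs run_state_tick run_state_simps

lemma runs_bind:
  assumes "runs w T\<^sub>1 P p R" and "\<And>x. runs w T\<^sub>2 (R x) (f x) Q"
  shows "runs w (T\<^sub>1 + T\<^sub>2) P (State_Monad.bind p f) Q"
  using assms unfolding runs_def run_state_bind
  by (fastforce split: prod.splits)

lemma runs_mono:
  assumes "runs w T P p Q" and "\<And>\<sigma>. P' \<sigma> \<Longrightarrow> P \<sigma>" and "\<And>x \<sigma>. Q x \<sigma> \<Longrightarrow> Q' x \<sigma>" and "T \<le> T'"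
  shows "runs w T' P' p Q'"
  using assms unfolding runs_def by (fastforce split: prod.splits)

text \<open>The branches share one bound \<open>T\<close>, so that their costs are not added; the
  cheaper branch is weakened to it.\<close>

lemma runs_cond:
  assumes "runs w T\<^sub>0 P b (\<lambda>x \<sigma>. if x then R\<^sub>1 \<sigma> else R\<^sub>2 \<sigma>)"
    and "runs w T R\<^sub>1 p Q" and "runs w T R\<^sub>2 q Q"
  shows "runs w (T\<^sub>0 + T) P (IF b THEN p ELSE q) Q"
  unfolding cond_def
proof (rule runs_bind[OF assms(1)])
  show "runs w T (\<lambda>\<sigma>. if x then R\<^sub>1 \<sigma> else R\<^sub>2 \<sigma>) (if x then p else q) Q" for x
    using assms(2,3) by (cases x) simp_all
qed

lemma runs_skip: "0 \<le> T \<Longrightarrow> runs w T P skip (\<lambda>_. P)"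
  by (simp add: runs_def run_state_val)

lemma runs_tick: "runs w (w p) (\<lambda>\<sigma>. P (\<sigma>\<lparr>trace := p # trace \<sigma>\<rparr>)) (tick p) (\<lambda>_. P)"
  by (simp add: runs_def run_state_tick time_def)

text \<open>Induction on the number of remaining iterations. The invariant is indexed by the loop
  variable, which lets it express progress and not only preservation. The condition
  \<open>a \<le> b + 1\<close> makes \<open>b + 1\<close> the exit value also for an empty
  range.\<close>

lemma runs_iterate:
  fixes a b :: int
  assumes body: "\<And>i. a \<le> i \<Longrightarrow> i \<le> b \<Longrightarrow> runs w T (I i) (body i) (\<lambda>_. I (i + 1))"
    and trace: "\<And>i \<sigma> t. I i (\<sigma>\<lparr>trace := t\<rparr>) = I i \<sigma>"
    and "a \<le> b + 1"
  shows "runs w (real_of_int (b + 1 - a) * (T + w Compare + w Arith) + w Compare) (I a)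
    (foldr (\<lambda>i rest. do { tick Compare; body i; tick Arith; rest }) [a..b] (tick Compare))
    (\<lambda>_. I (b + 1))"
  using body \<open>a \<le> b + 1\<close>
proof (induction "nat (b + 1 - a)" arbitrary: a)
  case 0
  then have "b + 1 = a" by simp
  then show ?case
    using runs_tick[of w Compare "I a"] by (auto simp: trace)
next
  case (Suc m)
  then have ab: "a \<le> b" by simp
  let ?loop = "\<lambda>xs. foldr (\<lambda>i rest. do { tick Compare; body i; tick Arith; rest }) xs (tick Compare)"
  let ?T = "real_of_int (b + 1 - (a + 1)) * (T + w Compare + w Arith) + w Compare"
  have tick: "runs w (w p) (I i) (tick p) (\<lambda>_. I i)" for p i
    using runs_tick[of w p "I i"] by (simp add: trace)
  have "runs w ?T (I (a + 1)) (?loop [a + 1..b]) (\<lambda>_. I (b + 1))"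
    using Suc.prems Suc.hyps(2) by (intro Suc.hyps(1)) auto
  then have "runs w (w Compare + (T + (w Arith + ?T))) (I a)
      (do { tick Compare; body a; tick Arith; ?loop [a + 1..b] }) (\<lambda>_. I (b + 1))"
    by (intro runs_bind[OF tick] runs_bind[OF Suc.prems(1)]) (use ab in auto)
  moreover have "w Compare + (T + (w Arith + ?T))
      = real_of_int (b + 1 - a) * (T + w Compare + w Arith) + w Compare"
    by (simp add: algebra_simps)
  ultimately show ?case
    by (simp only: upto_rec1[OF ab] foldr.simps o_apply)
qed

text \<open>The cost function is fixed here at one input, with \<open>w\<close> standing for
  \<open>cost n\<close>. The constant \<open>B\<close> is a parameter, so the numerals derived below
  cannot depend on the input.\<close>

locale bounded_costs =
  fixes w :: "operation \<Rightarrow> real" and B :: real and ss :: "'a list list" and n c :: nat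
  assumes w_nonneg: "0 \<le> w p"
    and w_const: "p \<in> {Arith, Compare, MinMax, Access, ReadChar, Append, Length} \<Longrightarrow> w p \<le> B"
    and w_bitwise: "0 \<le> a \<Longrightarrow> a < 2 ^ n \<Longrightarrow> 0 \<le> b \<Longrightarrow> b < 2 ^ n \<Longrightarrow> w (Bitwise a b) \<le> B"
    and w_power: "0 \<le> x \<Longrightarrow> x \<le> int n \<Longrightarrow> w (Power2 x) \<le> B"
    and w_search: "w (BinSearch m) \<le> B * (1 + log 2 (1 + real m))"
    and length_ss: "length ss = n"
    and length_le: "s \<in> set ss \<Longrightarrow> length s \<le> c"
    and n_pos: "1 \<le> n"
    and c_ge_2: "2 \<le> c"
begin

section \<open>Rules for loops and sequencing, with times in multiples of \<open>B\<close>\<close>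

lemma w_le: "w Arith \<le> B" "w Compare \<le> B" "w MinMax \<le> B" "w Access \<le> B" "w ReadChar \<le> B"
    "w Append \<le> B" "w Length \<le> B"
  by (simp_all add: w_const)

lemma B_nonneg: "0 \<le> B"
  using w_nonneg[of Arith] w_le(1) by linarith

lemma length_nth_le: "0 \<le> i \<Longrightarrow> i < int n \<Longrightarrow> length (ss ! nat i) \<le> c"
  by (rule length_le) (simp add: length_ss)

text \<open>The factor \<open>2 * k + 4\<close> counts \<open>k\<close> for each of the two range
  bounds, 1 for the final failing test, and 3 per iteration, because
  \<open>T + 2 \<le> 3 * T\<close>. The assumptions \<open>1 \<le> N\<close> and
  \<open>1 \<le> T\<close> allow the first two items to be charged to the product
  \<open>N * T * B\<close>.\<close>

lemma runs_for_loop: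
  assumes bounds: "runs w T\<^sub>0 P lo (\<lambda>x \<sigma>. x = a \<and> P \<sigma>)" "runs w T\<^sub>0 P hi (\<lambda>x \<sigma>. x = b \<and> I a \<sigma>)"
    and body: "\<And>i. a \<le> i \<Longrightarrow> i \<le> b \<Longrightarrow> runs w (T * B) (I i) (body i) (\<lambda>_. I (i + 1))"
    and trace: "\<And>i \<sigma> t. I i (\<sigma>\<lparr>trace := t\<rparr>) = I i \<sigma>"
    and exit: "\<And>\<sigma>. I (max a (b + 1)) \<sigma> \<Longrightarrow> Q \<sigma>"
    and N: "real_of_int (b + 1 - a) \<le> N" "1 \<le> N" and T: "1 \<le> T" and T\<^sub>0: "T\<^sub>0 \<le> k * B"
    and k: "0 \<le> k"
  shows "runs w ((2 * k + 4) * N * T * B) P (for_loop lo hi body) (\<lambda>_. Q)"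
proof -
  \<comment> \<open>Clipping at \<open>a - 1\<close> leaves the list of indices unchanged but
    restores \<open>a \<le> b' + 1\<close> when the range is empty by more than one, as
    \<open>runs_iterate\<close> requires.\<close>
  define b' where "b' = max b (a - 1)"
  have [simp]: "[a..b] = [a..b']" and b': "a \<le> b' + 1" "b' + 1 = max a (b + 1)"
      "real_of_int (b' + 1 - a) \<le> N" and body': "a \<le> i \<Longrightarrow> i \<le> b' \<Longrightarrow> i \<le> b" for i
    using N by (auto simp: b'_def max_def split: if_splits)
  let ?loop = "\<lambda>x y. foldr (\<lambda>i rest. do { tick Compare; body i; tick Arith; rest }) [x..y] (tick Compare)"
  let ?T = "real_of_int (b' + 1 - a) * (T * B + w Compare + w Arith) + w Compare"
  \<comment> \<open>The upper limit reaches the loop as a bound variable \<open>y\<close>. For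
    \<open>y\<close> different from \<open>b\<close> the precondition is false and the triple is
    vacuous.\<close>
  have "runs w ?T (\<lambda>\<sigma>. y = b \<and> I a \<sigma>) (?loop a y) (\<lambda>_. I (b' + 1))" for y
  proof (cases "y = b")
    case True
    then show ?thesis
      using runs_iterate[of a b' w "T * B" I body, OF body trace] b'(1) body' by simp
  qed (simp add: runs_def)
  from runs_bind[OF bounds(2) this]
  have "runs w (T\<^sub>0 + ?T) (\<lambda>\<sigma>. x = a \<and> P \<sigma>) (do { y \<leftarrow> hi; ?loop x y }) (\<lambda>_. I (b' + 1))" for x
    by (cases "x = a") (simp_all add: runs_def)
  from runs_bind[OF bounds(1) this]
  have "runs w (T\<^sub>0 + (T\<^sub>0 + ?T)) P (for_loop lo hi body) (\<lambda>_. I (b' + 1))"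
    unfolding for_loop_def .
  moreover have "T\<^sub>0 + (T\<^sub>0 + ?T) \<le> (2 * k + 4) * N * T * B"
  proof -
    have "real_of_int (b' + 1 - a) * (T * B + w Compare + w Arith) \<le> N * (T * B + 2 * B)"
      using b' N T B_nonneg w_nonneg[of Compare] w_nonneg[of Arith] w_le by (intro mult_mono) auto
    also have "\<dots> \<le> N * (T * B + 2 * (T * B))"
      using N T B_nonneg mult_right_mono[OF T B_nonneg] by (intro mult_left_mono) (auto simp: mult.commute)
    finally have "T\<^sub>0 + (T\<^sub>0 + ?T) \<le> (2 * k + 1) * (1 * 1 * B) + 3 * (N * T * B)"
      using T\<^sub>0 w_le(2) by (simp add: algebra_simps)
    also have "\<dots> \<le> (2 * k + 1) * (N * T * B) + 3 * (N * T * B)"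
      using N T k B_nonneg by (intro add_right_mono mult_left_mono mult_mono) auto
    finally show ?thesis
      by (simp add: algebra_simps)
  qed
  ultimately show ?thesis
    using exit b'(2) by (auto intro: runs_mono)
qed

text \<open>The upper limit \<open>n - 1\<close> costs one subtraction, so \<open>k = 1\<close> and
  the factor is 6. Nested loops over the strings give the factors 36 and 216 that appear
  later.\<close>

lemma runs_for_strings:
  assumes body: "\<And>i. 0 \<le> i \<Longrightarrow> i < int n \<Longrightarrow> runs w (T * B) (I i) (body i) (\<lambda>_. I (i + 1))"
    and trace: "\<And>i \<sigma> t. I i (\<sigma>\<lparr>trace := t\<rparr>) = I i \<sigma>"
    and "\<And>\<sigma>. I (int n) \<sigma> \<Longrightarrow> Q \<sigma>" and T: "1 \<le> T"
  shows "runs w (6 * real n * T * B) (I 0) (for_loop \<langle>0\<rangle> (\<langle>int n\<rangle> \<^bold>- \<langle>1\<rangle>) body) (\<lambda>_. Q)"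
proof -
  have "runs w ((2 * 1 + 4) * real n * T * B) (I 0) (for_loop \<langle>0\<rangle> (\<langle>int n\<rangle> \<^bold>- \<langle>1\<rangle>) body) (\<lambda>_. Q)"
    using assms w_le n_pos B_nonneg
    by (intro runs_for_loop[where I = I and a = 0 and b = "int n - 1" and T\<^sub>0 = B])
      (auto simp: exec_simps)
  then show ?thesis by simp
qed

lemma runs_num_strings:
  assumes "runs w (T * B) P (f (int n)) Q" and "\<And>\<sigma> t. P (\<sigma>\<lparr>trace := t\<rparr>) = P \<sigma>"
  shows "runs w ((T + 1) * B) P (num_strings ss \<bind> f) Q"
proof -
  have "runs w B P (num_strings ss) (\<lambda>x \<sigma>. x = int n \<and> P \<sigma>)"
    using w_le by (auto simp: exec_simps assms length_ss)
  from runs_bind[OF this, of "T * B" f Q]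
  have "runs w (B + T * B) P (num_strings ss \<bind> f) Q"
    using assms(1) by (auto simp: runs_def)
  then show ?thesis
    by (simp add: algebra_simps)
qed

lemma runs_then:
  assumes "runs w (T\<^sub>1 * B) P p R" and "\<And>x. runs w (T\<^sub>2 * B) (R x) (f x) Q"
  shows "runs w ((T\<^sub>1 + T\<^sub>2) * B) P (p \<bind> f) Q"
  using runs_bind[OF assms] by (simp add: distrib_right)

lemma runs_le:
  assumes "runs w (T * B) P p Q" and "T \<le> T'"
  shows "runs w (T' * B) P p Q"
  using assms(1) by (rule runs_mono) (auto intro: mult_right_mono assms B_nonneg)

lemma runs_if:
  assumes "runs w (T\<^sub>0 * B) P b (\<lambda>x \<sigma>. if x then R\<^sub>1 \<sigma> else R\<^sub>2 \<sigma>)"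
    and "runs w (T * B) R\<^sub>1 p Q" and "runs w (T * B) R\<^sub>2 q Q"
  shows "runs w ((T\<^sub>0 + T) * B) P (IF b THEN p ELSE q) Q"
  using runs_cond[OF assms] by (simp add: distrib_right)

section \<open>Mistakes for pairs\<close>

text \<open>The loops visit the keys \<open>(i, j, k)\<close> in lexicographic order, so the list of a key is
  empty until its turn and is extended at most \<open>c\<close> times afterwards.\<close>

definition from_key :: "int \<Rightarrow> int \<Rightarrow> int \<Rightarrow> int \<times> int \<times> int \<Rightarrow> bool" where
  "from_key i j k = (\<lambda>(i', j', k'). i < i' \<or> i = i' \<and> (j < j' \<or> j = j' \<and> k \<le> k'))"

text \<open>The predicate \<open>A\<close> marks the keys that are still untouched. When it is false
  everywhere, only the length bound remains, and it holds for all integer keys, including those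
  outside the ranges of the algorithm.\<close>

definition short_lists :: "(int \<times> int \<times> int \<Rightarrow> bool) \<Rightarrow> store \<Rightarrow> bool" where
  "short_lists A \<sigma> \<longleftrightarrow>
     (\<forall>key. length (mistakes \<sigma> key) \<le> c \<and> (A key \<longrightarrow> mistakes \<sigma> key = []))"

lemma short_lists_trace: "short_lists A (\<sigma>\<lparr>trace := t\<rparr>) = short_lists A \<sigma>"
  by (simp add: short_lists_def)

lemma short_lists_mono: "short_lists A \<sigma> \<Longrightarrow> (\<And>key. A' key \<Longrightarrow> A key) \<Longrightarrow> short_lists A' \<sigma>"
  by (auto simp: short_lists_def)

lemma runs_clear_mistakes:
  "runs w (36 * (real n ^ 2 * (1 + 32 * real c)) * B) (\<lambda>\<sigma>. \<forall>key. mistakes \<sigma> key = [])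
    (for_loop \<langle>0\<rangle> (\<langle>int n\<rangle> \<^bold>- \<langle>1\<rangle>) (\<lambda>i.
       for_loop \<langle>0\<rangle> (\<langle>int n\<rangle> \<^bold>- \<langle>1\<rangle>) (\<lambda>j.
         IF \<langle>j\<rangle> \<^bold>\<noteq> \<langle>i\<rangle> THEN
           for_loop \<langle>0\<rangle> (str_len ss i \<^bold>+ str_len ss j \<^bold>- \<langle>1\<rangle>) (\<lambda>k. set_mistakes i j k [])
         ELSE skip)))
    (\<lambda>_ \<sigma>. \<forall>key. mistakes \<sigma> key = [])"
  (is "runs w _ ?Q ?prog _")
proof -
  define P where "P = ?Q"
  have inner: "runs w ((2 * 6 + 4) * (2 * real c) * 1 * B) P
      (for_loop \<langle>0\<rangle> (str_len ss i \<^bold>+ str_len ss j \<^bold>- \<langle>1\<rangle>) (\<lambda>k. set_mistakes i j k [])) (\<lambda>_. P)"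
    if "0 \<le> i" "i < int n" "0 \<le> j" "j < int n" for i j
    using w_le c_ge_2 length_nth_le[of i] length_nth_le[of j] that B_nonneg
    by (intro runs_for_loop[where I = "\<lambda>_. P" and a = 0 and T\<^sub>0 = "6 * B"
          and b = "int (length (ss ! nat i)) + int (length (ss ! nat j)) - 1"])
      (auto simp: exec_simps P_def)
  have cond: "runs w ((1 + (2 * 6 + 4) * (2 * real c) * 1) * B) P
      (IF \<langle>j\<rangle> \<^bold>\<noteq> \<langle>i\<rangle> THEN
         for_loop \<langle>0\<rangle> (str_len ss i \<^bold>+ str_len ss j \<^bold>- \<langle>1\<rangle>) (\<lambda>k. set_mistakes i j k [])
       ELSE skip) (\<lambda>_. P)"
    if "0 \<le> i" "i < int n" "0 \<le> j" "j < int n" for i j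
    using w_le B_nonneg by (intro runs_if[OF _ inner[OF that] runs_skip]) (auto simp: exec_simps P_def)
  have "runs w (6 * real n * (6 * real n * (1 + 32 * real c)) * B) P ?prog (\<lambda>_. P)"
    using n_pos
    by (intro runs_for_strings[where I = "\<lambda>_. P"] cond[simplified]) (auto intro: mult_ge1_I simp: P_def)
  then show ?thesis
    by (simp add: power2_eq_square mult.assoc P_def)
qed

text \<open>The list of the current key starts empty and each iteration appends at most once, so it
  has at most \<open>t\<close> entries when iteration \<open>t\<close> begins. As \<open>t\<close>
  stays below the length of \<open>s_j\<close>, the length never exceeds \<open>c\<close>.\<close>

lemma runs_append_mistakes:
  assumes "0 \<le> i" "i < int n" "0 \<le> j" "j < int n"
  shows "runs w (10 * real c * 20 * B) (short_lists (from_key i j k))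
    (for_loop \<langle>0\<rangle> (str_len ss j \<^bold>- \<langle>1\<rangle>) (\<lambda>t. do {
       x \<leftarrow> \<langle>k\<rangle> \<^bold>- str_len ss j \<^bold>+ \<langle>1\<rangle> \<^bold>+ \<langle>t\<rangle>;
       IF \<langle>0\<rangle> \<^bold>\<le> \<langle>x\<rangle> \<^bold>\<and> \<langle>x\<rangle> \<^bold>< str_len ss i \<^bold>\<and> char_at ss j t \<^bold>\<noteq> char_at ss i x
       THEN append_mistake i j k x
       ELSE skip
     }))
    (\<lambda>_. short_lists (from_key i j (k + 1)))"
    (is "runs w _ _ ?prog _" is "runs w _ _ (for_loop _ _ ?body) _")
proof -
  define I where "I t \<sigma> \<longleftrightarrow> short_lists (from_key i j (k + 1)) \<sigma> \<and> length (mistakes \<sigma> (i, j, k)) \<le> nat t"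
    for t \<sigma>
  have start: "I 0 \<sigma>" if "short_lists (from_key i j k) \<sigma>" for \<sigma>
    using that by (auto simp: I_def short_lists_def from_key_def split: prod.splits)
  have body: "runs w (20 * B) (I t) (?body t) (\<lambda>_. I (t + 1))" if t: "0 \<le> t" "t < int c" for t
  proof -
    have trace: "I t (\<sigma>\<lparr>trace := tr\<rparr>) = I t \<sigma>" for t \<sigma> tr
      by (simp add: I_def short_lists_trace)
    have grow: "I (t + 1) (\<sigma>\<lparr>mistakes := (mistakes \<sigma>)((i, j, k) := mistakes \<sigma> (i, j, k) @ [x])\<rparr>)"
      if "I t \<sigma>" for \<sigma> x
      using that t by (auto simp: I_def short_lists_def from_key_def)
    have keep: "I (t + 1) \<sigma>" if "I t \<sigma>" for \<sigma>
      using that by (auto simp: I_def)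
    have "runs w ((5 + (9 + 2)) * B) (I t) (?body t) (\<lambda>_. I (t + 1))"
    proof (rule runs_then)
      show "runs w (5 * B) (I t) (\<langle>k\<rangle> \<^bold>- str_len ss j \<^bold>+ \<langle>1\<rangle> \<^bold>+ \<langle>t\<rangle>) (\<lambda>_. I t)"
        using w_le by (auto simp: exec_simps trace)
      show "runs w ((9 + 2) * B) (I t)
         (IF \<langle>0\<rangle> \<^bold>\<le> \<langle>x\<rangle> \<^bold>\<and> \<langle>x\<rangle> \<^bold>< str_len ss i \<^bold>\<and> char_at ss j t \<^bold>\<noteq> char_at ss i x
          THEN append_mistake i j k x
          ELSE skip) (\<lambda>_. I (t + 1))" for x
      proof (rule runs_if[where R\<^sub>1 = "I t" and R\<^sub>2 = "I t"])
        show "runs w (9 * B) (I t)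
           (\<langle>0\<rangle> \<^bold>\<le> \<langle>x\<rangle> \<^bold>\<and> \<langle>x\<rangle> \<^bold>< str_len ss i \<^bold>\<and> char_at ss j t \<^bold>\<noteq> char_at ss i x)
           (\<lambda>x \<sigma>. if x then I t \<sigma> else I t \<sigma>)"
          using w_le B_nonneg by (auto simp: exec_simps trace)
        show "runs w (2 * B) (I t) (append_mistake i j k x) (\<lambda>_. I (t + 1))"
          using w_le B_nonneg grow[of "\<sigma>\<lparr>trace := tr\<rparr>" for \<sigma> tr] by (auto simp: exec_simps trace)
        show "runs w (2 * B) (I t) skip (\<lambda>_. I (t + 1))"
          using B_nonneg keep by (auto simp: exec_simps)
      qed
    qed
    then show ?thesis
      by (rule runs_le) simp
  qed
  have "runs w ((2 * 3 + 4) * real c * 20 * B) (I 0) ?prog (\<lambda>_. short_lists (from_key i j (k + 1)))"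
    using length_nth_le[of j] assms w_le c_ge_2 B_nonneg
    by (intro runs_for_loop[where I = I and a = 0 and T\<^sub>0 = "3 * B"
          and b = "int (length (ss ! nat j)) - 1"] body)
      (auto simp: exec_simps I_def short_lists_trace)
  then show ?thesis
    using start by (auto intro: runs_mono)
qed

lemma runs_fill_mistakes:
  "runs w (36 * real n ^ 2 * (1 + 6400 * real c ^ 2) * B) (short_lists (from_key 0 0 0))
    (for_loop \<langle>0\<rangle> (\<langle>int n\<rangle> \<^bold>- \<langle>1\<rangle>) (\<lambda>i.
       for_loop \<langle>0\<rangle> (\<langle>int n\<rangle> \<^bold>- \<langle>1\<rangle>) (\<lambda>j.
         IF \<langle>j\<rangle> \<^bold>\<noteq> \<langle>i\<rangle> THEN
           for_loop \<langle>0\<rangle> (str_len ss i \<^bold>+ str_len ss j \<^bold>- \<langle>1\<rangle>) (\<lambda>k.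
             for_loop \<langle>0\<rangle> (str_len ss j \<^bold>- \<langle>1\<rangle>) (\<lambda>t. do {
               x \<leftarrow> \<langle>k\<rangle> \<^bold>- str_len ss j \<^bold>+ \<langle>1\<rangle> \<^bold>+ \<langle>t\<rangle>;
               IF \<langle>0\<rangle> \<^bold>\<le> \<langle>x\<rangle> \<^bold>\<and> \<langle>x\<rangle> \<^bold>< str_len ss i \<^bold>\<and> char_at ss j t \<^bold>\<noteq> char_at ss i x
               THEN append_mistake i j k x
               ELSE skip
             }))
         ELSE skip)))
    (\<lambda>_. short_lists (\<lambda>_. False))"
    (is "runs w _ _ ?prog _")
proof -
  \<comment> \<open>In lexicographic order, every key from \<open>(i, j + 1, 0)\<close> on comes
    after \<open>(i, j, k)\<close>, whatever value \<open>k\<close> has reached. This also covers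
    the case \<open>j = i\<close>, where nothing is written.\<close>
  have next_j: "short_lists (from_key i j k) \<sigma> \<Longrightarrow> short_lists (from_key i (j + 1) 0) \<sigma>"
    and next_i: "short_lists (from_key i j k) \<sigma> \<Longrightarrow> short_lists (from_key (i + 1) 0 0) \<sigma>" for i j k \<sigma>
    by (auto elim!: short_lists_mono simp: from_key_def)
  have cond: "runs w ((1 + 6400 * real c ^ 2) * B) (short_lists (from_key i j 0))
      (IF \<langle>j\<rangle> \<^bold>\<noteq> \<langle>i\<rangle> THEN
         for_loop \<langle>0\<rangle> (str_len ss i \<^bold>+ str_len ss j \<^bold>- \<langle>1\<rangle>) (\<lambda>k.
           for_loop \<langle>0\<rangle> (str_len ss j \<^bold>- \<langle>1\<rangle>) (\<lambda>t. do {
             x \<leftarrow> \<langle>k\<rangle> \<^bold>- str_len ss j \<^bold>+ \<langle>1\<rangle> \<^bold>+ \<langle>t\<rangle>;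
             IF \<langle>0\<rangle> \<^bold>\<le> \<langle>x\<rangle> \<^bold>\<and> \<langle>x\<rangle> \<^bold>< str_len ss i \<^bold>\<and> char_at ss j t \<^bold>\<noteq> char_at ss i x
             THEN append_mistake i j k x
             ELSE skip
           }))
       ELSE skip) (\<lambda>_. short_lists (from_key i (j + 1) 0))"
    (is "runs w _ _ (IF _ THEN ?loop ELSE skip) _")
    if ij: "0 \<le> i" "i < int n" "0 \<le> j" "j < int n" for i j
  proof (rule runs_if)
    show "runs w (1 * B) (short_lists (from_key i j 0)) (\<langle>j\<rangle> \<^bold>\<noteq> \<langle>i\<rangle>)
        (\<lambda>x \<sigma>. if x then short_lists (from_key i j 0) \<sigma> else short_lists (from_key i j 0) \<sigma>)"
      using w_le by (auto simp: exec_simps short_lists_trace)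
    have "runs w ((2 * 6 + 4) * (2 * real c) * (10 * real c * 20) * B) (short_lists (from_key i j 0))
        ?loop (\<lambda>_. short_lists (from_key i (j + 1) 0))"
      using w_le c_ge_2 length_nth_le[of i] length_nth_le[of j] ij B_nonneg
      by (intro runs_for_loop[where I = "\<lambda>k. short_lists (from_key i j k)" and a = 0
            and T\<^sub>0 = "6 * B"
            and b = "int (length (ss ! nat i)) + int (length (ss ! nat j)) - 1"]
          runs_append_mistakes)
        (auto simp: exec_simps short_lists_trace intro: next_j)
    then show "runs w (6400 * real c ^ 2 * B) (short_lists (from_key i j 0)) ?loop
        (\<lambda>_. short_lists (from_key i (j + 1) 0))"
      by (simp add: power2_eq_square mult.assoc)
    show "runs w (6400 * real c ^ 2 * B) (short_lists (from_key i j 0)) skip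
        (\<lambda>_. short_lists (from_key i (j + 1) 0))"
      using B_nonneg by (auto simp: exec_simps intro: next_j)
  qed
  let ?T = "1 + 6400 * real c ^ 2"
  have "runs w (6 * real n * (6 * real n * ?T) * B) (short_lists (from_key 0 0 0)) ?prog
      (\<lambda>_. short_lists (\<lambda>_. False))"
    using n_pos
    by (intro runs_for_strings[where I = "\<lambda>i. short_lists (from_key i 0 0)"]
        runs_for_strings[where I = "\<lambda>j. short_lists (from_key i j 0)" for i] cond)
      (auto intro: mult_ge1_I next_i elim: short_lists_mono simp: short_lists_trace)
  then show ?thesis
    by (simp add: power2_eq_square mult_ac)
qed

lemma runs_MISTAKES_FOR_PAIRS:
  "runs w (1000000 * real n ^ 2 * real c ^ 2 * B) (\<lambda>\<sigma>. \<forall>key. mistakes \<sigma> key = [])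
    (MISTAKES_FOR_PAIRS ss) (\<lambda>_. short_lists (\<lambda>_. False))"
proof -
  have "runs w ((36 * (real n ^ 2 * (1 + 32 * real c)) + 36 * real n ^ 2 * (1 + 6400 * real c ^ 2) + 1) * B)
    (\<lambda>\<sigma>. \<forall>key. mistakes \<sigma> key = []) (MISTAKES_FOR_PAIRS ss) (\<lambda>_. short_lists (\<lambda>_. False))"
    unfolding MISTAKES_FOR_PAIRS_def
    by (intro runs_num_strings runs_then[OF runs_clear_mistakes]
        runs_mono[OF runs_fill_mistakes])
      (auto simp: short_lists_def)
  moreover have "36 * (real n ^ 2 * (1 + 32 * real c)) + 36 * real n ^ 2 * (1 + 6400 * real c ^ 2) + 1
      \<le> 1000000 * real n ^ 2 * real c ^ 2"
  proof -
    \<comment> \<open>With \<open>x\<close> for \<open>c\<close> and \<open>y\<close> for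
      \<open>c^2\<close>, the estimate becomes linear.\<close>
    have arith: "36 * (1 + 32 * x) + 36 * (1 + 6400 * y) + 1 \<le> 1000000 * y"
      if "1 \<le> y" "x \<le> y" for x y :: real
      using that by (simp add: algebra_simps)
    have c: "1 \<le> real c ^ 2" "real c \<le> real c ^ 2"
      using c_ge_2 by (auto simp: power2_eq_square intro: mult_ge1_I)
    have "1 \<le> real n ^ 2" using n_pos by simp
    moreover have "36 * (1 + 32 * real c) + 36 * (1 + 6400 * real c ^ 2) + 1 \<le> 1000000 * real c ^ 2"
      using arith[OF c] .
    then have "real n ^ 2 * (36 * (1 + 32 * real c) + 36 * (1 + 6400 * real c ^ 2) + 1)
        \<le> real n ^ 2 * (1000000 * real c ^ 2)"
      by (rule mult_left_mono) simp
    ultimately show ?thesis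
      by (simp add: algebra_simps)
  qed
  ultimately show ?thesis
    by (rule runs_le)
qed

section \<open>Triples\<close>

definition lg :: real where
  "lg = log 2 (real c)"

text \<open>This lets constant costs be absorbed into multiples of \<open>lg\<close>; at
  \<open>c = 1\<close> the logarithm would be 0.\<close>

lemma lg_ge_1: "1 \<le> lg"
  using c_ge_2 by (simp add: le_log_iff lg_def)

abbreviation short :: "store \<Rightarrow> bool" where
  "short \<equiv> short_lists (\<lambda>_. False)"

text \<open>For \<open>c \<ge> 2\<close> one has \<open>1 + c \<le> 2 * c \<le> c^2\<close>, so the
  logarithm of \<open>1 + m\<close> is at most \<open>2 * lg\<close> for each list length
  \<open>m \<le> c\<close>.\<close>

lemma search_le:
  assumes "short \<sigma>"
  shows "w (BinSearch (length (mistakes \<sigma> key))) \<le> (1 + 2 * lg) * B"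
proof -
  let ?m = "length (mistakes \<sigma> key)"
  have "?m \<le> c"
    using assms unfolding short_lists_def by blast
  moreover have "1 + c \<le> c * c"
    using c_ge_2 mult_le_mono1[of 2 c c] by linarith
  ultimately have "1 + ?m \<le> c ^ 2"
    by (simp add: power2_eq_square)
  then have "1 + real ?m \<le> real c ^ 2"
    by (metis of_nat_1 of_nat_add of_nat_le_iff of_nat_power)
  then have "log 2 (1 + real ?m) \<le> log 2 (real c ^ 2)"
    using c_ge_2 by (subst log_le_cancel_iff) auto
  also have "\<dots> = 2 * lg"
    using c_ge_2 by (simp add: log_nat_power lg_def)
  finally have "B * (1 + log 2 (1 + real ?m)) \<le> B * (1 + 2 * lg)"
    using B_nonneg by (intro mult_left_mono) auto
  then show ?thesis
    using w_search[of ?m] by (simp add: mult.commute)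
qed

lemma runs_count_MS: "runs w ((40 + 2 * lg) * B) short (count_MS ss l m r len start) (\<lambda>_. short)"
  unfolding runs_def
proof (intro allI impI)
  fix \<sigma> assume short: "short \<sigma>"
  \<comment> \<open>The closed form of the position that the program computes, so that
    \<open>search_le\<close> is instantiated at exactly the key that is searched.\<close>
  define E' where
    "E' = start + int (length (ss ! nat m)) - 1 - (len - int (length (ss ! nat r)))"
  have "0 \<le> lg * B"
    using lg_ge_1 B_nonneg by simp
  then show "case run_state (count_MS ss l m r len start) \<sigma> of (x, \<sigma>') \<Rightarrow>
      short \<sigma>' \<and> time w \<sigma>' \<le> time w \<sigma> + (40 + 2 * lg) * B"
    using short search_le[OF short, of "(r, m, E')"] w_le B_nonneg
    by (auto simp: exec_simps count_MS_def short_lists_trace distrib_right E'_def)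
qed

text \<open>There are at most \<open>3 * c + 1 \<le> 4 * c\<close> starting positions. The upper
  limit costs 3 operations, which gives the factor \<open>2 * 3 + 4 = 10\<close>, and
  \<open>10 * 4 * 50 = 2000\<close>.\<close>

lemma runs_start_loop:
  assumes "0 \<le> m" "m < int n" "len \<le> 3 * int c"
  shows "runs w (2000 * real c * lg * B) short
    (for_loop \<langle>0\<rangle> (\<langle>len\<rangle> \<^bold>- str_len ss m) (\<lambda>start. do {
       MS \<leftarrow> count_MS ss l m r len start;
       IF \<langle>MS\<rangle> \<^bold>\<le> \<langle>int K\<rangle> THEN do {
         v \<leftarrow> min_expr \<langle>Fin len\<rangle> (fetch (\<lambda>\<sigma>. lmr \<sigma> (l, m, r)));
         set_lmr l m r v
       }
       ELSE skip
     }))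
    (\<lambda>_. short)"
    (is "runs w _ _ ?prog _" is "runs w _ _ (for_loop _ _ ?body) _")
proof -
  have body: "runs w (50 * lg * B) short (?body start) (\<lambda>_. short)" for start
  proof (rule runs_le[OF runs_then[OF runs_count_MS, of 4]])
    show "runs w (4 * B) short
        (IF \<langle>MS\<rangle> \<^bold>\<le> \<langle>int K\<rangle> THEN do {
           v \<leftarrow> min_expr \<langle>Fin len\<rangle> (fetch (\<lambda>\<sigma>. lmr \<sigma> (l, m, r)));
           set_lmr l m r v
         }
         ELSE skip) (\<lambda>_. short)" for MS
      using w_le B_nonneg by (auto simp: exec_simps short_lists_def)
    show "40 + 2 * lg + 4 \<le> 50 * lg"
      using lg_ge_1 by simp
  qed
  have "runs w ((2 * 3 + 4) * (4 * real c) * (50 * lg) * B) short ?prog (\<lambda>_. short)"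
    using assms w_le B_nonneg c_ge_2 lg_ge_1
    by (intro runs_for_loop[where I = "\<lambda>_. short" and a = 0 and T\<^sub>0 = "3 * B"
          and b = "len - int (length (ss ! nat m))"] body)
      (auto simp: exec_simps short_lists_trace)
  then show ?thesis
    by (simp add: mult.assoc)
qed

lemma runs_len_loop:
  assumes "0 \<le> l" "l < int n" "0 \<le> m" "m < int n" "0 \<le> r" "r < int n"
  shows "runs w (80 * real c * (20 + 2000 * real c * lg) * B) short
    (for_loop (max_expr (str_len ss l) (str_len ss r))
        (str_len ss l \<^bold>+ str_len ss r \<^bold>+ str_len ss m) (\<lambda>len.
       IF \<langle>len\<rangle> \<^bold>< str_len ss l \<^bold>+ str_len ss r \<^bold>\<and>
          (do {
             k \<leftarrow> str_len ss l \<^bold>+ str_len ss l \<^bold>+ str_len ss r \<^bold>- \<langle>len\<rangle> \<^bold>- \<langle>1\<rangle>;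
             num_mistakes l r k
           }) \<^bold>\<noteq> \<langle>0\<rangle>
       THEN skip
       ELSE for_loop \<langle>0\<rangle> (\<langle>len\<rangle> \<^bold>- str_len ss m) (\<lambda>start. do {
         MS \<leftarrow> count_MS ss l m r len start;
         IF \<langle>MS\<rangle> \<^bold>\<le> \<langle>int K\<rangle> THEN do {
           v \<leftarrow> min_expr \<langle>Fin len\<rangle> (fetch (\<lambda>\<sigma>. lmr \<sigma> (l, m, r)));
           set_lmr l m r v
         }
         ELSE skip
       })))
    (\<lambda>_. short)"
    (is "runs w _ _ ?prog _" is "runs w _ _ (for_loop _ _ ?body) _")
proof -
  have lengths: "length (ss ! nat l) \<le> c" "length (ss ! nat m) \<le> c" "length (ss ! nat r) \<le> c"
    using assms by (auto intro: length_nth_le)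
  have body: "runs w ((20 + 2000 * real c * lg) * B) short
      (?body len) (\<lambda>_. short)" if "len \<le> 3 * int c" for len
  proof (intro runs_if[where R\<^sub>1 = short and R\<^sub>2 = short] runs_skip runs_start_loop assms that)
    show "runs w (20 * B) short
        (\<langle>len\<rangle> \<^bold>< str_len ss l \<^bold>+ str_len ss r \<^bold>\<and>
          (do {
             k \<leftarrow> str_len ss l \<^bold>+ str_len ss l \<^bold>+ str_len ss r \<^bold>- \<langle>len\<rangle> \<^bold>- \<langle>1\<rangle>;
             num_mistakes l r k
           }) \<^bold>\<noteq> \<langle>0\<rangle>) (\<lambda>x \<sigma>. if x then short \<sigma> else short \<sigma>)"
      using w_le B_nonneg by (auto simp: exec_simps short_lists_trace)
  qed (use lg_ge_1 B_nonneg in simp)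
  have "runs w ((2 * 8 + 4) * (4 * real c) * (20 + 2000 * real c * lg) * B) short ?prog (\<lambda>_. short)"
    using lengths w_le B_nonneg c_ge_2 lg_ge_1
    by (intro runs_for_loop[where I = "\<lambda>_. short" and T\<^sub>0 = "8 * B"
          and a = "max (int (length (ss ! nat l))) (int (length (ss ! nat r)))"
          and b = "int (length (ss ! nat l)) + int (length (ss ! nat r)) + int (length (ss ! nat m))"]
        body)
      (auto simp: exec_simps short_lists_trace)
  then show ?thesis
    by simp
qed

lemma runs_pairwise_distinct:
  assumes "\<And>\<sigma> t. P (\<sigma>\<lparr>trace := t\<rparr>) = P \<sigma>"
  shows "runs w (3 * B) P (pairwise_distinct l m r) (\<lambda>x \<sigma>. if x then P \<sigma> else P \<sigma>)"
  using w_le B_nonneg by (auto simp: exec_simps assms)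

text \<open>Leaving the body arbitrary in its three indices makes the rule serve both the order
  \<open>l, r, m\<close> of the triples and the order \<open>l, m, r\<close> of the initialisation
  and the main loop.\<close>

lemma runs_for_triples:
  assumes "\<And>i j k. 0 \<le> i \<Longrightarrow> i < int n \<Longrightarrow> 0 \<le> j \<Longrightarrow> j < int n \<Longrightarrow> 0 \<le> k \<Longrightarrow> k < int n
      \<Longrightarrow> runs w (T * B) P (body i j k) (\<lambda>_. P)"
    and trace: "\<And>\<sigma> t. P (\<sigma>\<lparr>trace := t\<rparr>) = P \<sigma>" and T: "1 \<le> T"
  shows "runs w (216 * real n ^ 3 * T * B) P
    (for_loop \<langle>0\<rangle> (\<langle>int n\<rangle> \<^bold>- \<langle>1\<rangle>) (\<lambda>i.
       for_loop \<langle>0\<rangle> (\<langle>int n\<rangle> \<^bold>- \<langle>1\<rangle>) (\<lambda>j.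
         for_loop \<langle>0\<rangle> (\<langle>int n\<rangle> \<^bold>- \<langle>1\<rangle>) (\<lambda>k. body i j k))))
    (\<lambda>_. P)"
    (is "runs w _ _ ?prog _")
proof -
  have "runs w (6 * real n * (6 * real n * (6 * real n * T)) * B) P ?prog (\<lambda>_. P)"
    using T n_pos
    by (intro runs_for_strings[where I = "\<lambda>_. P"] assms(1)) (auto simp: trace intro!: mult_ge1_I)
  then show ?thesis
    by (simp add: power3_eq_cube mult_ac)
qed

lemma runs_SCSK_FOR_TRIPLES:
  "runs w (100000000 * real n ^ 3 * real c ^ 2 * lg * B) short (SCSK_FOR_TRIPLES ss K) (\<lambda>_. short)"
proof -
  let ?T = "3 + 80 * real c * (20 + 2000 * real c * lg)"
  have T: "1 \<le> ?T"
    using lg_ge_1 by simp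
  have "runs w ((216 * real n ^ 3 * 1 + 216 * real n ^ 3 * ?T + 1) * B) short
      (SCSK_FOR_TRIPLES ss K) (\<lambda>_. short)"
    unfolding SCSK_FOR_TRIPLES_def
  proof (intro runs_num_strings runs_then[where R = "\<lambda>_. short"] runs_for_triples T
      runs_if[where R\<^sub>1 = short and R\<^sub>2 = short] runs_pairwise_distinct runs_len_loop runs_skip)
    show "runs w (1 * B) short (set_lmr l m r \<infinity>) (\<lambda>_. short)" for l m r
      using w_le by (auto simp: exec_simps short_lists_def)
  qed (use lg_ge_1 B_nonneg in \<open>auto simp: short_lists_trace\<close>)
  moreover have "216 * real n ^ 3 * 1 + 216 * real n ^ 3 * ?T + 1
      \<le> 100000000 * real n ^ 3 * real c ^ 2 * lg"
  proof -
    have c: "1 \<le> real c" "1 \<le> real c * lg"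
      using c_ge_2 lg_ge_1 by (auto intro: mult_ge1_I)
    then have "1 \<le> real c ^ 2 * lg" "real c \<le> real c ^ 2 * lg"
      using c_ge_2 by (auto simp: power2_eq_square mult.assoc intro: mult_ge1_I)
    then have "216 + 216 * ?T + 1 \<le> 100000000 * (real c ^ 2 * lg)"
      by (simp add: algebra_simps power2_eq_square)
    then have "real n ^ 3 * (216 + 216 * ?T + 1) \<le> real n ^ 3 * (100000000 * (real c ^ 2 * lg))"
      by (rule mult_left_mono) simp
    moreover have "1 \<le> real n ^ 3"
      using n_pos by simp
    ultimately show ?thesis
      by (simp add: algebra_simps)
  qed
  ultimately show ?thesis
    by (rule runs_le)
qed

section \<open>Overlaps and dynamic programming\<close>

text \<open>No binary search occurs after the triples, so table contents no longer influence the
  bounds and the trivial invariant suffices.\<close>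

abbreviation anything :: "store \<Rightarrow> bool" where
  "anything \<equiv> \<lambda>_. True"

lemma runs_any: "runs w T P p Q \<Longrightarrow> runs w T P p (\<lambda>_. anything)"
  by (erule runs_mono) auto

lemma runs_for_pairs:
  assumes "\<And>i j. 0 \<le> i \<Longrightarrow> i < int n \<Longrightarrow> 0 \<le> j \<Longrightarrow> j < int n
      \<Longrightarrow> runs w (T * B) anything (body i j) (\<lambda>_. anything)" and T: "1 \<le> T"
  shows "runs w (36 * real n ^ 2 * T * B) anything
    (for_loop \<langle>0\<rangle> (\<langle>int n\<rangle> \<^bold>- \<langle>1\<rangle>) (\<lambda>i.
       for_loop \<langle>0\<rangle> (\<langle>int n\<rangle> \<^bold>- \<langle>1\<rangle>) (\<lambda>j. body i j)))
    (\<lambda>_. anything)"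
    (is "runs w _ _ ?prog _")
proof -
  have "runs w (6 * real n * (6 * real n * T) * B) anything ?prog (\<lambda>_. anything)"
    using T n_pos by (intro runs_for_strings assms(1)) (auto intro!: mult_ge1_I)
  then show ?thesis
    by (simp add: power2_eq_square mult_ac)
qed

lemma runs_COUNT_OVERLAPS:
  "runs w (10000 * real n ^ 2 * real c * B) anything (COUNT_OVERLAPS ss) (\<lambda>_. anything)"
proof (rule runs_le)
  show "runs w ((36 * real n ^ 2 * 1 + 36 * real n ^ 2 * (1 + 40 * real c) + 1) * B) anything
      (COUNT_OVERLAPS ss) (\<lambda>_. anything)"
    unfolding COUNT_OVERLAPS_def
  proof (intro runs_num_strings runs_then[where R = "\<lambda>_. anything"] runs_for_pairs
      runs_if[where R\<^sub>1 = anything and R\<^sub>2 = anything])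
    have const: "40 * real c \<ge> 3"
      using c_ge_2 by simp
    show "runs w (1 * B) anything (set_overlap i j 0) (\<lambda>_. anything)" for i j
      using w_le by (auto simp: exec_simps)
    show "runs w (40 * real c * B) anything
        (do { x \<leftarrow> str_len ss j; set_overlap i j x }) (\<lambda>_. anything)" for i j
      using w_le by (intro runs_le[OF _ const]) (auto simp: exec_simps)
    have "runs w ((2 * 2 + 4) * real c * 5 * B) anything
        (for_loop \<langle>1\<rangle> (str_len ss i) (\<lambda>ov.
           IF num_mistakes j i ov \<^bold>= \<langle>0\<rangle> THEN set_overlap i j ov ELSE skip)) (\<lambda>_. anything)"
      if "0 \<le> i" "i < int n" for i j
      using that w_le B_nonneg c_ge_2 length_nth_le[of i]
      by (intro runs_for_loop[where I = "\<lambda>_. anything" and a = 1 and T\<^sub>0 = "2 * B"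
            and b = "int (length (ss ! nat i))"])
        (auto simp: exec_simps)
    then show "runs w (40 * real c * B) anything
        (for_loop \<langle>1\<rangle> (str_len ss i) (\<lambda>ov.
           IF num_mistakes j i ov \<^bold>= \<langle>0\<rangle> THEN set_overlap i j ov ELSE skip)) (\<lambda>_. anything)"
      if "0 \<le> i" "i < int n" for i j
      using that by (simp add: mult_ac)
  qed (use w_le c_ge_2 in \<open>auto simp: exec_simps\<close>)
  have "36 + 36 * (1 + 40 * real c) + 1 \<le> 10000 * real c"
    using c_ge_2 by (simp add: algebra_simps)
  then have "real n ^ 2 * (36 + 36 * (1 + 40 * real c) + 1) \<le> real n ^ 2 * (10000 * real c)"
    by (rule mult_left_mono) simp
  moreover have "1 \<le> real n ^ 2"
    using n_pos by simp
  ultimately show "36 * real n ^ 2 * 1 + 36 * real n ^ 2 * (1 + 40 * real c) + 1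
      \<le> 10000 * real n ^ 2 * real c"
    by (simp add: algebra_simps)
qed

text \<open>The body may assume \<open>i < 2^n\<close>, which makes the mask a legal operand of a
  bitwise operation. The limit takes a power and a subtraction, hence
  \<open>2 * 2 + 4 = 8\<close>.\<close>

lemma runs_for_masks:
  assumes "\<And>i. a \<le> i \<Longrightarrow> i < 2 ^ n \<Longrightarrow> runs w (T * B) anything (body i) (\<lambda>_. anything)"
    and "a \<in> {0, 1}" and T: "1 \<le> T"
  shows "runs w (8 * 2 ^ n * T * B) anything (for_loop \<langle>a\<rangle> (pow2 (int n) \<^bold>- \<langle>1\<rangle>) body) (\<lambda>_. anything)"
proof -
  have "runs w ((2 * 2 + 4) * 2 ^ n * T * B) anything
      (for_loop \<langle>a\<rangle> (pow2 (int n) \<^bold>- \<langle>1\<rangle>) body) (\<lambda>_. anything)"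
    using assms w_le B_nonneg w_power[of "int n"]
    by (intro runs_for_loop[where I = "\<lambda>_. anything" and a = a and T\<^sub>0 = "2 * B" and b = "2 ^ n - 1"])
      (auto simp: exec_simps)
  then show ?thesis
    by simp
qed

lemma w_string:
  assumes "0 \<le> i" "i < int n"
  shows "w (Power2 i) \<le> B" "(2 :: int) ^ nat i < 2 ^ n"
  using assms w_power[of i] by (simp_all add: nat_less_iff)

text \<open>Abstracting over the table, its update and the overlap lookup treats both directions at
  once: they differ only in the table and in the order of the arguments of
  \<open>overlap\<close>.\<close>

lemma runs_fill_dp:
  fixes dp :: "store \<Rightarrow> int \<times> int \<Rightarrow> int extended" and ov :: "store \<Rightarrow> int \<Rightarrow> int \<Rightarrow> int"
  assumes set_dp: "\<And>msk j x. runs w (1 * B) anything (set_dp msk j x) (\<lambda>_. anything)"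
  shows "runs w (100000 * real n ^ 2 * 2 ^ n * B) anything (do {
     n \<leftarrow> num_strings ss;
     for_loop \<langle>0\<rangle> (pow2 n \<^bold>- \<langle>1\<rangle>) (\<lambda>msk.
       for_loop \<langle>0\<rangle> (\<langle>n\<rangle> \<^bold>- \<langle>1\<rangle>) (\<lambda>j. set_dp msk j \<infinity>));
     for_loop \<langle>0\<rangle> (\<langle>n\<rangle> \<^bold>- \<langle>1\<rangle>) (\<lambda>j. do {
       msk \<leftarrow> pow2 j;
       x \<leftarrow> fin (str_len ss j);
       set_dp msk j x
     });
     for_loop \<langle>1\<rangle> (pow2 n \<^bold>- \<langle>1\<rangle>) (\<lambda>msk.
       for_loop \<langle>0\<rangle> (\<langle>n\<rangle> \<^bold>- \<langle>1\<rangle>) (\<lambda>e.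
         IF pow2 e \<^bold>& \<langle>msk\<rangle> \<^bold>\<noteq> \<langle>0\<rangle> THEN
           for_loop \<langle>0\<rangle> (\<langle>n\<rangle> \<^bold>- \<langle>1\<rangle>) (\<lambda>p.
             IF pow2 p \<^bold>& \<langle>msk\<rangle> \<^bold>\<noteq> \<langle>0\<rangle> \<^bold>\<and> \<langle>p\<rangle> \<^bold>\<noteq> \<langle>e\<rangle> THEN do {
               msk' \<leftarrow> \<langle>msk\<rangle> \<^bold>\<oplus> pow2 e;
               v \<leftarrow> min_expr (fetch (\<lambda>\<sigma>. dp \<sigma> (msk, e)))
                     (fetch (\<lambda>\<sigma>. dp \<sigma> (msk', p)) \<^bold>+ fin (str_len ss e)
                       \<^bold>- fin (fetch (\<lambda>\<sigma>. ov \<sigma> p e)));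
               set_dp msk e v
             }
             ELSE skip)
         ELSE skip))
   }) (\<lambda>_. anything)"
    (is "runs w _ _ ?prog _")
proof (rule runs_le)
  \<comment> \<open>Per inner iteration: 4 for the test, 2 for the reduced mask, 10 for the minimum
    and 1 for the store. The leading 3 is the outer test.\<close>
  let ?T = "3 + 6 * real n * (4 + (2 + (10 + 1)))"
  show "runs w ((8 * 2 ^ n * (6 * real n * 1) + (6 * real n * (1 + (2 + 1))
      + 8 * 2 ^ n * (6 * real n * ?T)) + 1) * B) anything ?prog (\<lambda>_. anything)"
  proof (intro runs_num_strings runs_then[where R = "\<lambda>_. anything"] runs_for_masks
      runs_for_strings[where I = "\<lambda>_. anything"] runs_if[where R\<^sub>1 = anything and R\<^sub>2 = anything]
      set_dp)
    show "runs w (1 * B) anything (pow2 j) (\<lambda>_. anything)" if "0 \<le> j" "j < int n" for j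
      using w_string(1)[OF that] by (auto simp: exec_simps)
    show "runs w (3 * B) anything (pow2 e \<^bold>& \<langle>msk\<rangle> \<^bold>\<noteq> \<langle>0\<rangle>)
        (\<lambda>x \<sigma>. if x then True else True)" if "1 \<le> msk" "msk < 2 ^ n" "0 \<le> e" "e < int n" for msk e
      using that w_le w_string[of e] w_bitwise[of "2 ^ nat e" msk] by (auto simp: exec_simps)
    show "runs w (4 * B) anything (pow2 p \<^bold>& \<langle>msk\<rangle> \<^bold>\<noteq> \<langle>0\<rangle> \<^bold>\<and> \<langle>p\<rangle> \<^bold>\<noteq> \<langle>e\<rangle>)
        (\<lambda>x \<sigma>. if x then True else True)" if "1 \<le> msk" "msk < 2 ^ n" "0 \<le> p" "p < int n" for msk e p
      using that w_le B_nonneg w_string[of p] w_bitwise[of "2 ^ nat p" msk] by (auto simp: exec_simps)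
    show "runs w (2 * B) anything (\<langle>msk\<rangle> \<^bold>\<oplus> pow2 e) (\<lambda>_. anything)"
      if "1 \<le> msk" "msk < 2 ^ n" "0 \<le> e" "e < int n" for msk e
      using that w_string[of e] w_bitwise[of msk "2 ^ nat e"] by (auto simp: exec_simps)
  qed (use w_le B_nonneg n_pos in \<open>auto simp: exec_simps intro!: mult_ge1_I\<close>)
  let ?u = "real n * 2 ^ n" and ?v = "real n ^ 2 * 2 ^ n"
  have "1 \<le> ?u" "real n \<le> ?u" "?u \<le> ?v"
    using n_pos by (auto simp: power2_eq_square intro: mult_ge1_I)
  then have "192 * ?u + 4896 * ?v + 24 * real n + 1 \<le> 100000 * ?v"
    by linarith
  then show "8 * 2 ^ n * (6 * real n * 1) + (6 * real n * (1 + (2 + 1))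
      + 8 * 2 ^ n * (6 * real n * ?T)) + 1 \<le> 100000 * real n ^ 2 * 2 ^ n"
    by (simp add: algebra_simps power2_eq_square)
qed

lemma runs_FILL_DP_RIGHT:
  "runs w (100000 * real n ^ 2 * 2 ^ n * B) anything (FILL_DP_RIGHT ss) (\<lambda>_. anything)"
  unfolding FILL_DP_RIGHT_def
  using w_le by (intro runs_fill_dp[where dp = dp_right and ov = "\<lambda>\<sigma> p e. overlap \<sigma> (p, e)"])
    (auto simp: exec_simps)

lemma runs_FILL_DP_LEFT:
  "runs w (100000 * real n ^ 2 * 2 ^ n * B) anything (FILL_DP_LEFT ss) (\<lambda>_. anything)"
  unfolding FILL_DP_LEFT_def
  using w_le by (intro runs_fill_dp[where dp = dp_left and ov = "\<lambda>\<sigma> p e. overlap \<sigma> (e, p)"])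
    (auto simp: exec_simps)

section \<open>Main loop\<close>

lemma runs_mask_loop:
  assumes "0 \<le> l" "l < int n" "0 \<le> r" "r < int n"
  shows "runs w (8 * 2 ^ n * 40 * B) anything
    (for_loop \<langle>0\<rangle> (pow2 (int n) \<^bold>- \<langle>1\<rangle>) (\<lambda>leftMask. do {
       rightMask \<leftarrow> (pow2 (int n) \<^bold>- \<langle>1\<rangle>) \<^bold>\<oplus> \<langle>leftMask\<rangle>;
       IF \<langle>leftMask\<rangle> \<^bold>& pow2 l \<^bold>= \<langle>0\<rangle> \<^bold>\<or> \<langle>rightMask\<rangle> \<^bold>& pow2 r \<^bold>= \<langle>0\<rangle> THEN skip
       ELSE do {
         length' \<leftarrow> fetch (\<lambda>\<sigma>. lmr \<sigma> (l, m, r))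
           \<^bold>- fin (str_len ss l) \<^bold>- fin (str_len ss r)
           \<^bold>+ fetch (\<lambda>\<sigma>. dp_right \<sigma> (leftMask, l))
           \<^bold>+ fetch (\<lambda>\<sigma>. dp_left \<sigma> (rightMask, r));
         IF fetch ans \<^bold>= \<langle>None\<rangle> \<^bold>\<or> \<langle>length'\<rangle> \<^bold>< map_state the (fetch ans)
         THEN set_ans (Some length')
         ELSE skip
       }
     })) (\<lambda>_. anything)"
    (is "runs w _ _ (for_loop _ _ ?body) _")
proof (rule runs_for_masks)
  fix leftMask :: int
  assume mask: "0 \<le> leftMask" "leftMask < 2 ^ n"
  \<comment> \<open>Unlike the reduced mask in the dynamic programs, which only indexes a table,
    \<open>rightMask\<close> becomes an operand of a bitwise AND. Its range therefore has to be
    passed on as a postcondition.\<close>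
  let ?R = "\<lambda>x (_ :: store). 0 \<le> x \<and> x < (2 :: int) ^ n"
  note power = w_string[OF assms(1,2)] w_string[OF assms(3,4)]
  have update: "runs w ((11 + (6 + 1)) * B) anything
      (do {
         length' \<leftarrow> fetch (\<lambda>\<sigma>. lmr \<sigma> (l, m, r))
           \<^bold>- fin (str_len ss l) \<^bold>- fin (str_len ss r)
           \<^bold>+ fetch (\<lambda>\<sigma>. dp_right \<sigma> (leftMask, l))
           \<^bold>+ fetch (\<lambda>\<sigma>. dp_left \<sigma> (rightMask, r));
         IF fetch ans \<^bold>= \<langle>None\<rangle> \<^bold>\<or> \<langle>length'\<rangle> \<^bold>< map_state the (fetch ans)
         THEN set_ans (Some length')
         ELSE skip
       }) (\<lambda>_. anything)" for rightMask
    using w_le B_nonneg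
    by (intro runs_then[where R = "\<lambda>_. anything"] runs_if[where R\<^sub>1 = anything and R\<^sub>2 = anything])
      (auto simp: exec_simps)
  have test: "runs w (10 * B) (?R rightMask)
      (\<langle>leftMask\<rangle> \<^bold>& pow2 l \<^bold>= \<langle>0\<rangle> \<^bold>\<or> \<langle>rightMask\<rangle> \<^bold>& pow2 r \<^bold>= \<langle>0\<rangle>)
      (\<lambda>x \<sigma>. if x then anything \<sigma> else anything \<sigma>)" for rightMask
    using w_bitwise[of leftMask "2 ^ nat l"] w_bitwise[of rightMask "2 ^ nat r"] power mask
      w_le(2) B_nonneg
    by (auto simp: exec_simps)
  \<comment> \<open>\<open>XOR_upper\<close> keeps the result below \<open>2^n\<close>, since both
    operands are. The power \<open>2^n\<close> itself is never an operand, only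
    \<open>2^n - 1\<close>.\<close>
  have complement: "runs w (10 * B) anything ((pow2 (int n) \<^bold>- \<langle>1\<rangle>) \<^bold>\<oplus> \<langle>leftMask\<rangle>) ?R"
    using w_bitwise[of "2 ^ n - 1" leftMask] mask w_le(1) w_power[of "int n"] B_nonneg
    by (auto simp: exec_simps intro: XOR_upper)
  have "runs w ((10 + (10 + (11 + (6 + 1)))) * B) anything (?body leftMask) (\<lambda>_. anything)"
    by (rule runs_then[OF complement runs_if[OF test runs_skip update]]) (simp add: B_nonneg)
  then show "runs w (40 * B) anything (?body leftMask) (\<lambda>_. anything)"
    by (rule runs_le) simp
qed auto

lemma runs_MAIN_LOOP:
  "runs w (1000000 * real n ^ 3 * 2 ^ n * B) anything (MAIN_LOOP ss) (\<lambda>_. anything)"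
proof (rule runs_le)
  let ?T = "3 + 8 * 2 ^ n * 40 :: real"
  show "runs w ((1 + (216 * real n ^ 3 * ?T + 1) + 1) * B) anything (MAIN_LOOP ss) (\<lambda>_. anything)"
    unfolding MAIN_LOOP_def
  proof (intro runs_num_strings runs_then[where R = "\<lambda>_. anything"] runs_for_triples
      runs_if[where R\<^sub>1 = anything and R\<^sub>2 = anything] runs_mask_loop runs_pairwise_distinct runs_skip)
    show "1 \<le> ?T"
      by simp
  qed (use w_le B_nonneg in \<open>auto simp: exec_simps\<close>)
  have "216 * (3 + 8 * x * 40) + 3 \<le> 1000000 * x" if "1 \<le> x" for x :: real
    using that by simp
  from this[of "2 ^ n"] have "216 * ?T + 3 \<le> 1000000 * 2 ^ n"
    by simp
  then have "real n ^ 3 * (216 * ?T + 3) \<le> real n ^ 3 * (1000000 * 2 ^ n)"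
    by (rule mult_left_mono) simp
  moreover have "1 \<le> real n ^ 3"
    using n_pos by simp
  ultimately show "1 + (216 * real n ^ 3 * ?T + 1) + 1 \<le> 1000000 * real n ^ 3 * 2 ^ n"
    by (simp add: algebra_simps)
qed

section \<open>Sum over all phases\<close>

lemma running_time_SCSK:
  "time w (snd (run_state (SCSK ss K) initial_store))
     \<le> 200000000 * B * (real n ^ 3 * real c ^ 2 * log 2 (real c) + real n ^ 3 * 2 ^ n)"
proof -
  let ?X = "real n ^ 3 * real c ^ 2 * lg" and ?Y = "real n ^ 3 * 2 ^ n"
  have "runs w ((1000000 * real n ^ 2 * real c ^ 2 + (100000000 * real n ^ 3 * real c ^ 2 * lg
      + ((10000 * real n ^ 2 * real c
          + (100000 * real n ^ 2 * 2 ^ n + 100000 * real n ^ 2 * 2 ^ n))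
      + 1000000 * real n ^ 3 * 2 ^ n))) * B)
      (\<lambda>\<sigma>. \<forall>key. mistakes \<sigma> key = []) (SCSK ss K) (\<lambda>_. anything)"
    unfolding SCSK_def SCS_FIRST_LAST_def
    by (intro runs_then[OF runs_MISTAKES_FOR_PAIRS] runs_then[OF runs_any[OF runs_SCSK_FOR_TRIPLES]]
        runs_then[OF runs_then[OF runs_COUNT_OVERLAPS runs_then[OF runs_FILL_DP_RIGHT runs_FILL_DP_LEFT]]]
        runs_MAIN_LOOP)
  then have "runs w (200000000 * (?X + ?Y) * B)
      (\<lambda>\<sigma>. \<forall>key. mistakes \<sigma> key = []) (SCSK ss K) (\<lambda>_. anything)"
  proof (rule runs_le)
    have n: "real n ^ 2 \<le> real n ^ 3"
      using n_pos by (intro power_increasing) auto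
    have c: "real c ^ 2 * 1 \<le> real c ^ 2 * lg" "real c \<le> real c ^ 2"
      using c_ge_2 lg_ge_1 by (auto simp: power2_eq_square)
    \<comment> \<open>The pair and overlap phases are of lower order: one more factor
      \<open>n\<close> and \<open>lg \<ge> 1\<close> absorb them into the cost of the
      triples.\<close>
    have "real n ^ 2 * real c ^ 2 \<le> ?X" "real n ^ 2 * real c \<le> ?X"
      using mult_mono[OF n, of "real c ^ 2" "real c ^ 2 * lg"]
        mult_mono[OF n, of "real c" "real c ^ 2 * lg"] c by (simp_all add: mult.assoc)
    moreover have "real n ^ 2 * 2 ^ n \<le> ?Y"
      using n by (intro mult_right_mono) auto
    moreover have "0 \<le> ?X" "0 \<le> ?Y"
      using lg_ge_1 by auto
    \<comment> \<open>Naming the products by real variables turns the summation into linear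
      arithmetic.\<close>
    moreover have "1000000 * a + (100000000 * x + ((10000 * b + (100000 * d + 100000 * d)) + 1000000 * y))
        \<le> 200000000 * (x + y)" if "a \<le> x" "b \<le> x" "d \<le> y" "0 \<le> x" "0 \<le> y" for a b d x y :: real
      using that by simp
    ultimately show "1000000 * real n ^ 2 * real c ^ 2 + (100000000 * real n ^ 3 * real c ^ 2 * lg
      + ((10000 * real n ^ 2 * real c
          + (100000 * real n ^ 2 * 2 ^ n + 100000 * real n ^ 2 * 2 ^ n))
      + 1000000 * real n ^ 3 * 2 ^ n)) \<le> 200000000 * (?X + ?Y)"
      unfolding mult.assoc by blast
  qed
  then have "time w (snd (run_state (SCSK ss K) initial_store))
      \<le> time w initial_store + 200000000 * (?X + ?Y) * B"
    by (rule runs_time) (simp add: initial_store_def)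
  then show ?thesis
    by (simp add: time_def initial_store_def lg_def mult_ac)
qed

end

theorem theorem1:
  fixes cost :: "nat \<Rightarrow> operation \<Rightarrow> real"
  assumes "cost_model cost"
  shows "\<exists>C. \<forall>(ss :: 'a list list) (K :: nat) n c.
           valid_input ss \<and> n = length ss \<and> c = max_length ss \<and> n \<ge> 1 \<and> c \<ge> 2 \<longrightarrow>
           running_time cost ss K
             \<le> C * (real n ^ 3 * real c ^ 2 * log 2 (real c) + real n ^ 3 * 2 ^ n)"
proof -
  \<comment> \<open>\<open>B\<close> is obtained before any input is fixed, because the cost model
    provides it uniformly in \<open>n\<close>. This is what makes \<open>200000000 * B\<close> a
    single constant for all inputs.\<close>
  obtain B where costs: "bounded_costs (cost (length ss)) B ss (length ss) (max_length ss)"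
    if "1 \<le> length ss" "2 \<le> max_length ss" for ss :: "'a list list"
  proof -
    from assms obtain B where B: "\<forall>n.
        (\<forall>p\<in>{Arith, Compare, MinMax, Access, ReadChar, Append, Length}. cost n p \<le> B) \<and>
        (\<forall>a b. 0 \<le> a \<and> a < 2 ^ n \<and> 0 \<le> b \<and> b < 2 ^ n \<longrightarrow> cost n (Bitwise a b) \<le> B) \<and>
        (\<forall>x. 0 \<le> x \<and> x \<le> int n \<longrightarrow> cost n (Power2 x) \<le> B) \<and>
        (\<forall>m. cost n (BinSearch m) \<le> B * (1 + log 2 (1 + real m)))"
      and nonneg: "\<forall>n p. 0 \<le> cost n p"
      unfolding cost_model_def by blast
    show thesis
    proof (rule that)
      fix ss :: "'a list list"
      assume "1 \<le> length ss" "2 \<le> max_length ss"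
      moreover have "length s \<le> max_length ss" if "s \<in> set ss" for s
        using that by (simp add: max_length_def)
      ultimately show "bounded_costs (cost (length ss)) B ss (length ss) (max_length ss)"
        using B nonneg by unfold_locales blast+
    qed
  qed
  have "running_time cost ss K
      \<le> 200000000 * B * (real (length ss) ^ 3 * real (max_length ss) ^ 2 * log 2 (real (max_length ss))
          + real (length ss) ^ 3 * 2 ^ length ss)"
    if "1 \<le> length ss" "2 \<le> max_length ss" for ss :: "'a list list" and K
    using bounded_costs.running_time_SCSK[OF costs[OF that], of K]
    by (simp add: running_time_def time_def)
  then show ?thesis
    by blast
qed

end
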